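(* Let $q$ be a prime power, $V$ an $n$-dimensional vector space over $\mathbb{F}_q$, $\mathcal{V}$ the set of all subspaces of $V$ and $\mathcal{V}_m\subseteq\mathcal{V}$ the set of $m$-dimensional subspaces. Let $k,\ell$ be integers with $1\leqslant \ell<k\leqslant \lfloor n/2\rfloor$. Put $c=\left[{n-1\atop k-1}\right]_q^{1/2}\left[{n-1\atop \ell-1}\right]_q^{1/2}$ and, for $\lambda\in\mathbb{R}$, define real numbers $a(\lambda),b(\lambda)$ by $$q^{k^2}(q^k-1)\left[{n-k\atop k}\right]_q a(\lambda)=\tfrac12 q^{\ell}(q^{k-\ell}-1)\,c+q^{\ell^2}(q^\ell-1)\left[{n-\ell\atop \ell}\right]_q\lambda,$$ $$q^{k\ell}\left[{n-k\atop \ell}\right]_q b(\lambda)=-\tfrac12 q^{\ell}\left[{n-1\atop \ell}\right]_q-q^{\ell^2}\left[{n-\ell\atop \ell}\right]_q\left[{n-1\atop \ell-1}\right]_q^{1/2}\left[{n-1\atop k-1}\right]_q^{-1/2}\lambda.$$ Set $\alpha=\beta=\tfrac12 c$, $\gamma=b(\lambda)$ and $A=a(\lambda)\overline{W}_{k,k}+\lambda\overline{W}_{\ell,\ell}$. Then there exists $\lambda_0>0$ such that for every $0<\lambda<\lambda_0$, $(\alpha,\beta,\gamma,A)$ is a feasible solution to the problem (D), i.e. $A$ is symmetric and entrywise nonnegative, and the matrix $$S=\alpha I_k+\beta I_\ell-\tfrac12(J_{k,\ell}+J_{\ell,k})-\gamma(\overline{W}_{k,\ell}+\overline{W}_{\ell,k})-A$$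 is positive semidefinite.
   Context: Gaussian coefficients: $\left[{a\atop b}\right]_q=\prod_{i=0}^{b-1}\frac{q^{a-i}-1}{q^{b-i}-1}$, interpreted as $0$ if $a<0$ or $b<0$. All matrices are real with rows and columns indexed by $\mathcal{V}$. For $k,\ell\in\{0,\dots,n\}$: $(W_{k,\ell})_{x,y}=1$ if $x\in\mathcal{V}_k$, $y\in\mathcal{V}_\ell$ and $\dim(x\cap y)=\min\{k,\ell\}$, and $0$ otherwise; $(\overline{W}_{k,\ell})_{x,y}=1$ if $x\in\mathcal{V}_k$, $y\in\mathcal{V}_\ell$ and $x\cap y=0$, and $0$ otherwise. $I_k=W_{k,k}$ (the diagonal projection onto coordinates in $\mathcal{V}_k$), and $J_{k,\ell}=I_kJI_\ell$ where $J$ is the all-ones matrix. *)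

theory Defs
  imports "HOL-Analysis.Analysis"
begin

text \<open>
  The arguments are integers so that \<open>a - i\<close> is not truncated; for \<open>0 \<le> a < b\<close> the factor with
  \<open>i = a\<close> makes the product vanish.
\<close>

definition gauss_coeff :: "real \<Rightarrow> int \<Rightarrow> int \<Rightarrow> real" where
  "gauss_coeff q a b =
     (if a < 0 \<or> b < 0 then 0
      else (\<Prod>i<nat b. (q powi (a - int i) - 1) / (q powi (b - int i) - 1)))"

text \<open>
  The vector space is the whole type \<open>'v\<close>, with scalar multiplication \<open>smul\<close>. The index set of
  all matrices is the set of its subspaces. It is not a type, so a matrix is a function on pairs of
  sets of which only the values at pairs of subspaces matter; products, entrywise conditions and
  quadratic forms range over subspaces only.
\<close>

definition subspaces :: "('f::field \<Rightarrow> 'v::ab_group_add \<Rightarrow> 'v) \<Rightarrow> 'v set set" where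
  "subspaces smul = {x. module.subspace smul x}"

definition subspaces_dim :: "('f::field \<Rightarrow> 'v::ab_group_add \<Rightarrow> 'v) \<Rightarrow> nat \<Rightarrow> 'v set set" where
  "subspaces_dim smul m = {x \<in> subspaces smul. vector_space.dim smul x = m}"

type_synonym 'v smat = "'v set \<Rightarrow> 'v set \<Rightarrow> real"

definition smat_mult :: "('f::field \<Rightarrow> 'v::ab_group_add \<Rightarrow> 'v) \<Rightarrow> 'v smat \<Rightarrow> 'v smat \<Rightarrow> 'v smat" where
  "smat_mult smul M N = (\<lambda>x y. \<Sum>z\<in>subspaces smul. M x z * N z y)"

definition smat_symmetric :: "('f::field \<Rightarrow> 'v::ab_group_add \<Rightarrow> 'v) \<Rightarrow> 'v smat \<Rightarrow> bool" where
  "smat_symmetric smul M \<longleftrightarrow>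
     (\<forall>x\<in>subspaces smul. \<forall>y\<in>subspaces smul. M x y = M y x)"

definition smat_nonneg :: "('f::field \<Rightarrow> 'v::ab_group_add \<Rightarrow> 'v) \<Rightarrow> 'v smat \<Rightarrow> bool" where
  "smat_nonneg smul M \<longleftrightarrow> (\<forall>x\<in>subspaces smul. \<forall>y\<in>subspaces smul. 0 \<le> M x y)"

definition smat_psd :: "('f::field \<Rightarrow> 'v::ab_group_add \<Rightarrow> 'v) \<Rightarrow> 'v smat \<Rightarrow> bool" where
  "smat_psd smul M \<longleftrightarrow> smat_symmetric smul M \<and>
     (\<forall>u :: 'v set \<Rightarrow> real.
        0 \<le> (\<Sum>x\<in>subspaces smul. \<Sum>y\<in>subspaces smul. u x * M x y * u y))"

definition W_mat :: "('f::field \<Rightarrow> 'v::ab_group_add \<Rightarrow> 'v) \<Rightarrow> nat \<Rightarrow> nat \<Rightarrow> 'v smat" where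
  "W_mat smul k l = (\<lambda>x y.
     if x \<in> subspaces_dim smul k \<and> y \<in> subspaces_dim smul l \<and>
        vector_space.dim smul (x \<inter> y) = min k l
     then 1 else 0)"

definition W_bar :: "('f::field \<Rightarrow> 'v::ab_group_add \<Rightarrow> 'v) \<Rightarrow> nat \<Rightarrow> nat \<Rightarrow> 'v smat" where
  "W_bar smul k l = (\<lambda>x y.
     if x \<in> subspaces_dim smul k \<and> y \<in> subspaces_dim smul l \<and> x \<inter> y = {0}
     then 1 else 0)"

definition I_mat :: "('f::field \<Rightarrow> 'v::ab_group_add \<Rightarrow> 'v) \<Rightarrow> nat \<Rightarrow> 'v smat" where
  "I_mat smul k = W_mat smul k k"

definition J_mat :: "('f::field \<Rightarrow> 'v::ab_group_add \<Rightarrow> 'v) \<Rightarrow> nat \<Rightarrow> nat \<Rightarrow> 'v smat" where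
  "J_mat smul k l = smat_mult smul (smat_mult smul (I_mat smul k) (\<lambda>x y. 1)) (I_mat smul l)"

definition slack_mat :: "('f::field \<Rightarrow> 'v::ab_group_add \<Rightarrow> 'v) \<Rightarrow> nat \<Rightarrow> nat \<Rightarrow>
    real \<Rightarrow> real \<Rightarrow> real \<Rightarrow> 'v smat \<Rightarrow> 'v smat" where
  "slack_mat smul k l \<alpha> \<beta> \<gamma> A = (\<lambda>x y.
     \<alpha> * I_mat smul k x y + \<beta> * I_mat smul l x y
     - 1/2 * (J_mat smul k l x y + J_mat smul l k x y)
     - \<gamma> * (W_bar smul k l x y + W_bar smul l k x y)
     - A x y)"

definition feasible_D :: "('f::field \<Rightarrow> 'v::ab_group_add \<Rightarrow> 'v) \<Rightarrow> nat \<Rightarrow> nat \<Rightarrow>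
    real \<Rightarrow> real \<Rightarrow> real \<Rightarrow> 'v smat \<Rightarrow> bool" where
  "feasible_D smul k l \<alpha> \<beta> \<gamma> A \<longleftrightarrow>
     smat_symmetric smul A \<and> smat_nonneg smul A \<and>
     smat_psd smul (slack_mat smul k l \<alpha> \<beta> \<gamma> A)"

end

theory Submission
  imports Defs
begin

text \<open>
  A function on the \<open>k\<close>-spaces is a sum of lifts of harmonic functions, one on the \<open>i\<close>-spaces for each
  \<open>i \<le> k\<close>, where \<open>h\<close> is harmonic if its sums over the \<open>i\<close>-spaces through each \<open>(i - 1)\<close>-space vanish.
  Lifts from different levels are orthogonal, and the disjointness matrices act on each level as
  scalars, so the slack matrix splits into blocks of size at most two. The blocks 0 and 1 are
  singular for every \<open>lam\<close>, which is what the equations for \<open>a\<close> and \<open>b\<close> express, and they are positive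
  semidefinite because their diagonals are nonnegative. The blocks for \<open>i \<ge> 2\<close> are positive definite
  at \<open>lam = 0\<close>, as the eigenvalues decay fast enough in \<open>i\<close>, and stay so for small \<open>lam\<close>.
\<close>

section \<open>Gaussian binomial coefficients\<close>

text \<open>In the comments below, [m] stands for \<open>qnum q m\<close>. The determinants of the
  blocks 0 and 1 leave no slack for any \<open>lam\<close>, so no limit argument can decide them and
  exact identities are required. The remaining determinant conditions are strict at
  \<open>lam = 0\<close> and finite in number, which is where the positive bound for
  \<open>lam\<close> comes from. For \<open>i >= 2\<close> the off-diagonal entry requires a bound
  on \<open>b 0\<close>; the singularity of block 1 provides it, because its determinant equation
  expresses \<open>(b 0)^2\<close> through diagonal entries. On level \<open>i\<close> a
  disjointness matrix acts as a count times (-1)^i q^(i(i-1)/2). Passing from \<open>i\<close> to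
  \<open>i + 1\<close> multiplies the power by q^i and divides the count by at least q^k or q^l;
  together with \<open>q >= 2\<close> this gap yields the constants 1/2 and 8. The condition
  \<open>2 * k <= n\<close> enters the decomposition by keeping the scalars q^i [n-k-i] of the
  down-up operator nonzero.\<close>

definition qnum :: "real \<Rightarrow> nat \<Rightarrow> real" where
  "qnum q m = (\<Sum>i<m. q ^ i)"

lemma qnum_0 [simp]: "qnum q 0 = 0"
  and qnum_1 [simp]: "qnum q (Suc 0) = 1"
  by (simp_all add: qnum_def)

lemma qnum_geometric: "(q - 1) * qnum q m = q ^ m - 1"
  unfolding qnum_def by (simp add: power_diff_1_eq)

lemma qnum_add: "qnum q (a + b) = qnum q a + q ^ a * qnum q b"
  by (induction b) (simp_all add: qnum_def power_add algebra_simps)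

lemma qnum_diff: "a \<le> b \<Longrightarrow> qnum q b = qnum q a + q ^ a * qnum q (b - a)"
  using qnum_add[of q a "b - a"] by simp

lemma qnum_pos: "0 < q \<Longrightarrow> 0 < m \<Longrightarrow> 0 < qnum q m"
  unfolding qnum_def by (intro sum_pos) auto

lemma qnum_nonneg: "0 \<le> q \<Longrightarrow> 0 \<le> qnum q m"
  unfolding qnum_def by (intro sum_nonneg) auto

lemma qnum_mono: "0 \<le> q \<Longrightarrow> a \<le> b \<Longrightarrow> qnum q a \<le> qnum q b"
  using qnum_diff[of a b q] by (simp add: qnum_nonneg)

text \<open>Truncated subtraction is harmless here: for \<open>a < b\<close> the numerator contains
  \<open>qnum q 0\<close>, so the value is 0.\<close>

definition qbinom :: "real \<Rightarrow> nat \<Rightarrow> nat \<Rightarrow> real" where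
  "qbinom q a b = (\<Prod>s<b. qnum q (a - s)) / (\<Prod>s<b. qnum q (Suc s))"

lemma qbinom_0 [simp]: "qbinom q a 0 = 1"
  by (simp add: qbinom_def)

lemma qnum_Suc_pos: "0 < q \<Longrightarrow> 0 < qnum q (Suc m)"
  by (simp add: qnum_pos)

lemma qbinom_Suc:
  assumes "0 < q"
  shows "qbinom q a (Suc b) * qnum q (Suc b) = qbinom q a b * qnum q (a - b)"
  using qnum_Suc_pos[OF assms, of b] by (simp add: qbinom_def)

text \<open>Absorption: shifting the numerator by one index splits off its first factor, while the
  denominator gains its last one.\<close>

lemma qbinom_Suc_Suc:
  assumes "0 < q"
  shows "qbinom q (Suc a) (Suc b) * qnum q (Suc b) = qnum q (Suc a) * qbinom q a b"
  using qnum_Suc_pos[OF assms, of b]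
  by (simp add: qbinom_def prod.lessThan_Suc_shift[of _ b] prod.lessThan_Suc[of "\<lambda>s. qnum q (Suc s)"]
      del: prod.lessThan_Suc)

lemma qbinom_pos:
  assumes "0 < q" "b \<le> a"
  shows "0 < qbinom q a b"
  unfolding qbinom_def using assms
  by (intro divide_pos_pos prod_pos ballI) (auto intro!: qnum_pos)

text \<open>This is (-1)^i q^(i(i-1)/2), the Moebius function of the lattice of subspaces of an
  \<open>i\<close>-space. It enters through \<open>layer_bottom\<close>.\<close>

definition qsign :: "real \<Rightarrow> nat \<Rightarrow> real" where
  "qsign q i = (\<Prod>s<i. - (q ^ s))"

lemma prod_lessThan_add:
  fixes f :: "nat \<Rightarrow> real"
  shows "(\<Prod>s<a + b. f s) = (\<Prod>s<a. f s) * (\<Prod>s<b. f (a + s))"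
  by (induction b) (simp_all add: algebra_simps)

text \<open>Splitting off \<open>a\<close> factors and then \<open>b\<close>, or \<open>b\<close>
  and then \<open>a\<close>, exhausts the same falling product of \<open>a + b\<close>
  factors.\<close>

lemma qbinom_trinomial:
  assumes "a + b \<le> m"
  shows "qbinom q (m - a) b * qbinom q m a = qbinom q (m - b) a * qbinom q m b"
proof -
  have *: "(\<Prod>s<u. qnum q (m - s)) * (\<Prod>s<v. qnum q (m - u - s)) = (\<Prod>s<u + v. qnum q (m - s))" for u v
    by (simp add: prod_lessThan_add)
  show ?thesis using *[of a b] *[of b a]
    by (simp add: qbinom_def add.commute mult.commute)
qed

lemma real_card_Diff:
  assumes "finite A" "B \<subseteq> A"
  shows "real (card (A - B)) = real (card A) - real (card B)"
  using assms by (simp add: card_Diff_subset card_mono finite_subset of_nat_diff)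

lemma double_count:
  assumes "finite A" "finite B"
  shows "(\<Sum>a\<in>A. real (card {b \<in> B. R a b})) = (\<Sum>b\<in>B. real (card {a \<in> A. R a b}))"
  using sum.swap_restrict[OF assms, of "\<lambda>_ _. 1 :: real" R] by simp

text \<open>
  \<open>opp_count q n i l k\<close> counts the \<open>l\<close>-spaces that contain a given \<open>i\<close>-space and meet a
  given \<open>k\<close>-space trivially; \<open>norm_factor q n i k\<close> is the factor by which lifting from the \<open>i\<close>-spaces to the
  \<open>k\<close>-spaces stretches the squared norm of a harmonic function.
\<close>

definition opp_count :: "real \<Rightarrow> nat \<Rightarrow> nat \<Rightarrow> nat \<Rightarrow> nat \<Rightarrow> real" where
  "opp_count q n i l k = q ^ (k * (l - i)) * qbinom q (n - k - i) (l - i)"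

definition norm_factor :: "real \<Rightarrow> nat \<Rightarrow> nat \<Rightarrow> nat \<Rightarrow> real" where
  "norm_factor q n i k = q ^ (i * (k - i)) * qbinom q (n - 2 * i) (k - i)"

lemma gauss_coeff_eq_qbinom:
  assumes "1 < q" "b \<le> a"
  shows "gauss_coeff q (int a) (int b) = qbinom q a b"
proof -
  have factor: "(q powi (int a - int i) - 1) / (q powi (int b - int i) - 1) = qnum q (a - i) / qnum q (b - i)"
    if "i < b" for i
  proof -
    have "int a - int i = int (a - i)" "int b - int i = int (b - i)" using that assms(2) by auto
    hence "(q powi (int a - int i) - 1) / (q powi (int b - int i) - 1) = (q ^ (a - i) - 1) / (q ^ (b - i) - 1)"
      by (simp only: power_int_of_nat)
    also have "\<dots> = ((q - 1) * qnum q (a - i)) / ((q - 1) * qnum q (b - i))"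
      by (simp only: qnum_geometric)
    finally show ?thesis using assms(1) by simp
  qed
  have "gauss_coeff q (int a) (int b) = (\<Prod>i<b. qnum q (a - i) / qnum q (b - i))"
    by (simp add: gauss_coeff_def factor)
  also have "\<dots> = (\<Prod>i<b. qnum q (a - i)) / (\<Prod>i<b. qnum q (b - i))" by (rule prod_dividef)
  \<comment> \<open>The denominators run downwards from \<open>b\<close> in
    \<open>gauss_coeff\<close> and upwards from 1 in \<open>qbinom\<close>.\<close>
  also have "(\<Prod>i<b. qnum q (b - i)) = (\<Prod>i<b. qnum q (Suc i))"
    using prod.nat_diff_reindex[of "\<lambda>s. qnum q (Suc s)" b] by (simp add: Suc_diff_Suc)
  finally show ?thesis by (simp only: qbinom_def)
qed

lemma opp_count_pos:
  assumes "0 < q" "i \<le> l" "k + l \<le> n"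
  shows "0 < opp_count q n i l k"
  unfolding opp_count_def using assms by (intro mult_pos_pos qbinom_pos) auto

lemma norm_factor_pos:
  assumes "0 < q" "i \<le> k" "2 * k \<le> n"
  shows "0 < norm_factor q n i k"
  unfolding norm_factor_def using assms by (intro mult_pos_pos qbinom_pos) auto

text \<open>Behind it is a double count of pairs of an \<open>(i + 1)\<close>-space in an
  \<open>l\<close>-space, both through a fixed \<open>i\<close>-space and disjoint from the
  \<open>k\<close>-space. The proof is algebraic, by absorption.\<close>

lemma opp_count_rec:
  assumes "0 < q" "i < l" "k + l \<le> n"
  shows "opp_count q n (Suc i) l k * (q ^ k * qnum q (n - k - i)) = opp_count q n i l k * qnum q (l - i)"
proof -
  obtain m where m: "l - i = Suc m" using assms(2) by (metis Suc_diff_Suc)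
  obtain r where r: "n - k - i = Suc r" using assms(2,3) by (cases "n - k - i") auto
  have idx: "l - Suc i = m" "n - k - Suc i = r" using m r by auto
  have "opp_count q n (Suc i) l k * (q ^ k * qnum q (n - k - i)) =
      q ^ k * q ^ (k * m) * (qnum q (Suc r) * qbinom q r m)"
    by (simp only: opp_count_def idx r mult_ac)
  also have "\<dots> = q ^ k * q ^ (k * m) * (qbinom q (Suc r) (Suc m) * qnum q (Suc m))"
    by (simp only: qbinom_Suc_Suc[OF assms(1)])
  also have "\<dots> = opp_count q n i l k * qnum q (l - i)"
    by (simp only: opp_count_def m r mult_Suc_right power_add mult_ac)
  finally show ?thesis .
qed

text \<open>In \<open>opp_count_rec\<close> the quotient of [l-i] by [n-k-i] is at most 1, since
  \<open>l <= n - k\<close>.\<close>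

lemma opp_count_decreasing:
  assumes "0 < q" "i < l" "k + l \<le> n"
  shows "opp_count q n (Suc i) l k * q ^ k \<le> opp_count q n i l k"
proof -
  have pos: "0 < qnum q (n - k - i)" using assms by (intro qnum_pos) auto
  have "(opp_count q n (Suc i) l k * q ^ k) * qnum q (n - k - i) = opp_count q n i l k * qnum q (l - i)"
    using opp_count_rec[OF assms] by (simp only: mult.assoc)
  also have "\<dots> \<le> opp_count q n i l k * qnum q (n - k - i)"
    using opp_count_pos[of q i l k n] assms by (intro mult_left_mono qnum_mono) auto
  finally show ?thesis using pos by simp
qed

text \<open>Both sides arise from pairing the two lifts of one harmonic function through the
  disjointness relation, evaluated from the \<open>k\<close>-side and from the
  \<open>l\<close>-side. Algebraically it is \<open>qbinom_trinomial\<close> with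
  \<open>m = n - 2 * i\<close>.\<close>

lemma opp_count_norm_factor:
  assumes "i \<le> l" "i \<le> k" "k + l \<le> n"
  shows "opp_count q n i l k * norm_factor q n i k = opp_count q n i k l * norm_factor q n i l"
proof -
  have idx: "n - k - i = n - 2 * i - (k - i)" "n - l - i = n - 2 * i - (l - i)" using assms by auto
  \<comment> \<open>Both exponents equal \<open>k * l - i^2\<close>.\<close>
  have pw: "k * (l - i) + i * (k - i) = l * (k - i) + i * (l - i)"
    using assms by (auto simp: algebra_simps le_iff_add)
  have "opp_count q n i l k * norm_factor q n i k =
    q ^ (k * (l - i) + i * (k - i)) *
      (qbinom q (n - 2 * i - (k - i)) (l - i) * qbinom q (n - 2 * i) (k - i))"
    by (simp only: opp_count_def norm_factor_def idx power_add mult_ac)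
  also have "\<dots> = q ^ (l * (k - i) + i * (l - i)) *
      (qbinom q (n - 2 * i - (l - i)) (k - i) * qbinom q (n - 2 * i) (l - i))"
    using assms by (simp only: pw, subst qbinom_trinomial) auto
  also have "\<dots> = opp_count q n i k l * norm_factor q n i l"
    by (simp only: opp_count_def norm_factor_def idx power_add mult_ac)
  finally show ?thesis .
qed

lemma abs_qsign_Suc: "0 < q \<Longrightarrow> \<bar>qsign q (Suc i)\<bar> = q ^ i * \<bar>qsign q i\<bar>"
  by (simp add: qsign_def abs_mult)

lemma qsign_simps [simp]: "qsign q 0 = 1" "qsign q (Suc 0) = -1"
  by (simp_all add: qsign_def)

section \<open>Harmonic functions on the Grassmannians\<close>

locale finite_field_space =
  finite_dimensional_vector_space scale Basis
  for scale :: "'f::{field,finite} \<Rightarrow> 'v::ab_group_add \<Rightarrow> 'v" (infixr \<open>*s\<close> 75) and Basis +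
  fixes Q :: real
  assumes Q_def: "Q = real CARD('f)"
begin

abbreviation Gr :: "nat \<Rightarrow> 'v set set" where
  "Gr d \<equiv> subspaces_dim scale d"

lemma Gr_iff: "x \<in> Gr d \<longleftrightarrow> subspace x \<and> dim x = d"
  by (simp add: subspaces_dim_def subspaces_def)

lemma Q_ge_2: "2 \<le> Q"
proof -
  have "card {0, 1 :: 'f} \<le> CARD('f)" by (intro card_mono) auto
  thus ?thesis by (simp add: Q_def)
qed

lemma span_of_subspace [simp]: "subspace x \<Longrightarrow> span x = x"
  by (simp only: span_eq_iff)

lemma finite_span: "finite S \<Longrightarrow> finite (span S)"
proof (induction S rule: finite_induct)
  case (insert v S)
  have "span (insert v S) \<subseteq> (\<lambda>(r, w). r *s v + w) ` (UNIV \<times> span S)"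
  proof
    fix x assume "x \<in> span (insert v S)"
    then obtain r where "x - r *s v \<in> span S" by (auto simp: span_insert)
    thus "x \<in> (\<lambda>(r, w). r *s v + w) ` (UNIV \<times> span S)"
      by (intro image_eqI[of _ _ "(r, x - r *s v)"]) auto
  qed
  thus ?case by (rule finite_subset) (use insert in auto)
qed auto

lemma finite_UNIV: "finite (UNIV :: 'v set)"
  using finite_span[OF finite_Basis] by (simp add: span_Basis)

lemma finite_vectors [simp]: "finite (x :: 'v set)"
  using finite_UNIV by (rule rev_finite_subset) simp

lemma finite_sets [simp]: "finite (X :: 'v set set)"
proof -
  have "finite (UNIV :: 'v set set)" using finite_UNIV by (simp add: Finite_Set.finite_set)
  thus ?thesis by (rule rev_finite_subset) simp
qed

lemma card_span_insert:
  assumes "subspace y" "v \<notin> y"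
  shows "card (span (insert v y)) = CARD('f) * card y"
proof -
  have sy: "span y = y" using assms by simp
  have img: "span (insert v y) = (\<lambda>(r, w). r *s v + w) ` (UNIV \<times> y)"
  proof (intro equalityI subsetI)
    fix x assume "x \<in> span (insert v y)"
    then obtain r where "x - r *s v \<in> y" by (auto simp: span_insert sy)
    thus "x \<in> (\<lambda>(r, w). r *s v + w) ` (UNIV \<times> y)"
      by (intro image_eqI[of _ _ "(r, x - r *s v)"]) auto
  next
    fix x assume "x \<in> (\<lambda>(r, w). r *s v + w) ` (UNIV \<times> y)"
    then obtain r w where "x = r *s v + w" "w \<in> y" by auto
    thus "x \<in> span (insert v y)"
      by (simp add: span_add span_scale span_base)
  qed
  have "inj_on (\<lambda>(r, w). r *s v + w) (UNIV \<times> y)"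
  proof (rule inj_onI, clarify)
    fix r w r' w'
    assume w: "w \<in> y" "w' \<in> y" and eq: "r *s v + w = r' *s v + w'"
    have "(r - r') *s v = w' - w" using eq by (simp add: scale_left_diff_distrib algebra_simps)
    hence *: "(r - r') *s v \<in> y" using w assms(1) by (simp add: subspace_diff)
    have "r = r'"
    proof (rule ccontr)
      assume "r \<noteq> r'"
      hence "v = inverse (r - r') *s ((r - r') *s v)" by simp
      thus False using * assms by (metis subspace_scale)
    qed
    thus "r = r' \<and> w = w'" using eq by simp
  qed
  thus ?thesis by (simp add: img card_image card_cartesian_product)
qed

lemma card_subspace:
  assumes "subspace x"
  shows "card x = CARD('f) ^ dim x"
proof -
  have *: "card (span C) = CARD('f) ^ card C" if "independent C" for C
  proof -
    have "finite C" by simp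
    thus ?thesis using that
    proof (induction C rule: finite_induct)
      case (insert v C)
      hence "v \<notin> span C" "independent C" by (auto simp: independent_insert)
      moreover have "span (insert v (span C)) = span (insert v C)" by (simp add: span_insert)
      ultimately show ?case using card_span_insert[of "span C" v] insert by simp
    qed simp
  qed
  obtain C where "independent C" "span C = x" "card C = dim x"
    using basis_subspace_exists[OF assms] by metis
  thus ?thesis using * by metis
qed

lemma real_card_subspace: "subspace x \<Longrightarrow> real (card x) = Q ^ dim x"
  by (simp add: card_subspace Q_def)

lemma Gr_0: "Gr 0 = {{0}}"
  by (auto simp: Gr_iff subspace_0 intro: subspace_0)

lemma Gr_eq: "x \<in> Gr d \<Longrightarrow> y \<in> Gr d \<Longrightarrow> x \<subseteq> y \<Longrightarrow> x = y"
  using subspace_dim_equal[of x y] by (simp add: Gr_iff)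

text \<open>By counting pairs: the map \<open>(s, t) \<mapsto> s + t\<close> is \<open>card (x \<inter> y)\<close> to one.\<close>

lemma dim_join_meet:
  assumes "subspace x" "subspace y"
  shows "dim (span (x \<union> y)) + dim (x \<inter> y) = dim x + dim y"
proof -
  let ?f = "\<lambda>(s, t). s + t"
  have img: "span (x \<union> y) = ?f ` (x \<times> y)"
    using assms by (simp add: span_Un) auto
  have fibre: "card {p \<in> x \<times> y. ?f p = v} = card (x \<inter> y)" if "v \<in> ?f ` (x \<times> y)" for v
  proof -
    from that obtain s t where st: "s \<in> x" "t \<in> y" "v = s + t" by auto
    have "bij_betw (\<lambda>w. (s + w, t - w)) (x \<inter> y) {p \<in> x \<times> y. ?f p = v}"
    proof (rule bij_betwI[where g = "\<lambda>(a, b). a - s"])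
      show "(\<lambda>(a, b). a - s) \<in> {p \<in> x \<times> y. ?f p = v} \<rightarrow> x \<inter> y"
      proof clarify
        fix a b assume ab: "a \<in> x" "b \<in> y" "v = a + b"
        hence "a - s = t - b" using st(3) by (simp add: algebra_simps)
        thus "a - s \<in> x \<inter> y" using ab st assms subspace_diff by (metis IntI)
      qed
    qed (use st assms in \<open>auto simp: subspace_add subspace_diff algebra_simps\<close>)
    thus ?thesis by (rule bij_betw_same_card[symmetric])
  qed
  have "card (x \<times> y) = (\<Sum>v\<in>?f ` (x \<times> y). card {p \<in> x \<times> y. ?f p = v})"
    using sum.image_gen[of "x \<times> y" "\<lambda>_. 1::nat" ?f] by simp
  also have "\<dots> = card (span (x \<union> y)) * card (x \<inter> y)"
    using fibre by (simp add: img)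
  finally have "CARD('f) ^ (dim x + dim y) = CARD('f) ^ (dim (span (x \<union> y)) + dim (x \<inter> y))"
    using assms by (simp add: card_cartesian_product card_subspace subspace_inter power_add)
  moreover have "1 < CARD('f)" using Q_ge_2 by (simp add: Q_def)
  ultimately show ?thesis using power_inject_exp by metis
qed

lemma dim_span_insert: "subspace y \<Longrightarrow> v \<notin> y \<Longrightarrow> dim (span (insert v y)) = Suc (dim y)"
  by (simp only: dim_span dim_insert span_of_subspace if_False Suc_eq_plus1)

lemma cover_eq_span_insert:
  assumes "y' \<in> Gr (Suc (dim y))" "subspace y" "y \<subseteq> y'" "v \<in> y'" "v \<notin> y"
  shows "y' = span (insert v y)"
proof -
  have "span (insert v y) \<subseteq> y'"
    using assms by (intro span_minimal) (auto simp: Gr_iff)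
  thus ?thesis
    using assms by (intro Gr_eq[of _ "Suc (dim y)", symmetric]) (simp_all add: Gr_iff dim_span_insert del: dim_span)
qed

text \<open>Every vector of \<open>s - y\<close> lies in exactly one cover of \<open>y\<close>, the
  span of \<open>y\<close> and that vector. So the sets \<open>y' - y\<close> partition
  \<open>s - y\<close> into pieces of equal size.\<close>

lemma card_covers:
  assumes "subspace y" "subspace s" "y \<subseteq> s"
  shows "real (card {y' \<in> Gr (Suc (dim y)). y \<subseteq> y' \<and> y' \<subseteq> s}) = qnum Q (dim s - dim y)"
proof -
  let ?C = "{y' \<in> Gr (Suc (dim y)). y \<subseteq> y' \<and> y' \<subseteq> s}"
  have cover: "s - y = (\<Union>y'\<in>?C. y' - y)"
  proof (intro equalityI subsetI)
    fix v assume v: "v \<in> s - y"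
    have "span (insert v y) \<in> ?C"
    proof -
      have "span (insert v y) \<subseteq> s" using v assms by (intro span_minimal) auto
      moreover have "y \<subseteq> span (insert v y)" by (auto intro: span_base)
      ultimately show ?thesis using v assms by (simp add: Gr_iff dim_span_insert del: dim_span)
    qed
    moreover have "v \<in> span (insert v y)" by (simp add: span_base)
    ultimately show "v \<in> (\<Union>y'\<in>?C. y' - y)" using v by blast
  qed auto
  have "card (s - y) = (\<Sum>y'\<in>?C. card (y' - y))"
    unfolding cover
  proof (rule card_UN_disjoint)
    show "\<forall>i\<in>?C. \<forall>j\<in>?C. i \<noteq> j \<longrightarrow> (i - y) \<inter> (j - y) = {}"
    proof (intro ballI impI, rule ccontr)
      fix i j assume ij: "i \<in> ?C" "j \<in> ?C" "i \<noteq> j" and ne: "(i - y) \<inter> (j - y) \<noteq> {}"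
      from ne obtain v where v: "v \<in> i" "v \<in> j" "v \<notin> y" by blast
      have "i = span (insert v y)" "j = span (insert v y)"
        by (rule cover_eq_span_insert; use ij v assms in simp)+
      thus False using ij by simp
    qed
  qed auto
  hence "real (card (s - y)) = (\<Sum>y'\<in>?C. real (card (y' - y)))" by simp
  also have "\<dots> = (\<Sum>y'\<in>?C. Q ^ Suc (dim y) - Q ^ dim y)"
  proof (rule sum.cong)
    fix y' assume "y' \<in> ?C"
    hence "y \<subseteq> y'" "subspace y'" "dim y' = Suc (dim y)" by (auto simp: Gr_iff)
    thus "real (card (y' - y)) = Q ^ Suc (dim y) - Q ^ dim y"
      using assms by (simp add: card_Diff_subset of_nat_diff card_mono real_card_subspace)
  qed simp
  finally have C: "real (card (s - y)) = real (card ?C) * (Q ^ Suc (dim y) - Q ^ dim y)" by simp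
  have d: "dim y \<le> dim s" using assms(3) by (rule dim_subset)
  have "real (card ?C) * (Q ^ dim y * (Q - 1)) = real (card ?C) * (Q ^ Suc (dim y) - Q ^ dim y)"
    by (simp add: algebra_simps)
  also have "\<dots> = Q ^ dim s - Q ^ dim y"
    unfolding C[symmetric] using assms
    by (simp add: card_Diff_subset of_nat_diff card_mono real_card_subspace)
  also have "\<dots> = Q ^ dim y * (Q ^ (dim s - dim y) - 1)"
    using d by (simp add: right_diff_distrib flip: power_add)
  also have "\<dots> = qnum Q (dim s - dim y) * (Q ^ dim y * (Q - 1))"
    by (simp flip: qnum_geometric)
  finally show ?thesis using Q_ge_2 by simp
qed

abbreviation n :: nat where
  "n \<equiv> dim (UNIV :: 'v set)"

abbreviation eps :: "nat \<Rightarrow> real" where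
  "eps \<equiv> qsign Q"

abbreviation e :: "nat \<Rightarrow> real" where
  "e \<equiv> qnum Q"

lemma Q_pos: "0 < Q"
  using Q_ge_2 by linarith

lemma e_pos: "0 < m \<Longrightarrow> 0 < e m"
  using Q_pos by (rule qnum_pos)

text \<open>
  Pairs consisting of a hyperplane \<open>w\<close> of \<open>z\<close> through \<open>t\<close> and a cover of \<open>t\<close> in \<open>z\<close> that is not
  contained in \<open>w\<close> are counted in two ways.
\<close>

lemma card_hyperplanes:
  assumes "z \<in> Gr (Suc j)" "subspace t" "t \<subseteq> z" "dim t \<le> j"
  shows "real (card {w \<in> Gr j. t \<subseteq> w \<and> w \<subseteq> z}) = e (Suc j - dim t)"
  using assms(2-)
proof (induction "j - dim t" arbitrary: t)
  case 0
  hence "{w \<in> Gr j. t \<subseteq> w \<and> w \<subseteq> z} = {t}"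
    using Gr_eq[of t j] by (auto simp: Gr_iff)
  moreover have "Suc j - dim t = Suc 0" using 0 by simp
  ultimately show ?case by simp
next
  case (Suc m)
  define d where "d = dim t"
  have d: "d < j" using Suc.hyps(2) by (simp add: d_def)
  have dz: "dim z = Suc j" "subspace z" using assms(1) by (auto simp: Gr_iff)
  let ?H = "{w \<in> Gr j. t \<subseteq> w \<and> w \<subseteq> z}"
  let ?C = "{p \<in> Gr (Suc d). t \<subseteq> p \<and> p \<subseteq> z}"
  have C: "real (card ?C) = e (Suc j - d)"
    using card_covers[OF Suc.prems(1) dz(2) Suc.prems(2)] dz by (simp add: d_def)
  have 1: "real (card {p \<in> ?C. \<not> p \<subseteq> w}) = Q ^ (j - d)" if "w \<in> ?H" for w
  proof -
    have w: "subspace w" "dim w = j" "t \<subseteq> w" "w \<subseteq> z" using that by (auto simp: Gr_iff)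
    have "{p \<in> ?C. \<not> p \<subseteq> w} = ?C - {p \<in> Gr (Suc d). t \<subseteq> p \<and> p \<subseteq> w}" by auto
    moreover have "{p \<in> Gr (Suc d). t \<subseteq> p \<and> p \<subseteq> w} \<subseteq> ?C" using w by auto
    ultimately have "real (card {p \<in> ?C. \<not> p \<subseteq> w}) = e (Suc j - d) - e (j - d)"
      using card_covers[OF Suc.prems(1) w(1) w(3)] w(2) C
      by (simp add: card_Diff_subset of_nat_diff card_mono d_def)
    also have "\<dots> = Q ^ (j - d)"
      using d qnum_add[of Q "j - d" 1] by (simp add: Suc_diff_le)
    finally show ?thesis .
  qed
  have 2: "real (card {w \<in> ?H. \<not> p \<subseteq> w}) = real (card ?H) - e (j - d)" if "p \<in> ?C" for p
  proof -
    have p: "subspace p" "dim p = Suc d" "t \<subseteq> p" "p \<subseteq> z" using that by (auto simp: Gr_iff)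
    have "{w \<in> ?H. \<not> p \<subseteq> w} = ?H - {w \<in> Gr j. p \<subseteq> w \<and> w \<subseteq> z}" by auto
    moreover have "{w \<in> Gr j. p \<subseteq> w \<and> w \<subseteq> z} \<subseteq> ?H" using p by auto
    moreover have "real (card {w \<in> Gr j. p \<subseteq> w \<and> w \<subseteq> z}) = e (Suc j - dim p)"
      using Suc.hyps(2) d p by (intro Suc.hyps(1)) (auto simp: d_def)
    ultimately show ?thesis
      using p by (simp add: card_Diff_subset of_nat_diff card_mono)
  qed
  \<comment> \<open>The unknown \<open>card ?H\<close> occurs on both sides; collecting it leaves
    the coefficient [j-d], which is positive because \<open>d < j\<close>.\<close>
  have "real (card ?H) * Q ^ (j - d) = e (Suc j - d) * (real (card ?H) - e (j - d))"
    using double_count[of ?H ?C "\<lambda>w p. \<not> p \<subseteq> w"] 1 2 C by simp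
  moreover have "e (Suc j - d) = e (j - d) + Q ^ (j - d)"
    using d qnum_add[of Q "j - d" 1] by (simp add: Suc_diff_le)
  ultimately have "real (card ?H) * e (j - d) = e (Suc j - d) * e (j - d)"
    by (simp add: algebra_simps)
  moreover have "e (j - d) > 0" using d by (intro e_pos) simp
  ultimately show ?case by (simp add: d_def)
qed

section \<open>Lifting operators, harmonic functions and intersection layers\<close>

definition up :: "nat \<Rightarrow> ('v set \<Rightarrow> real) \<Rightarrow> 'v set \<Rightarrow> real" where
  "up i h x = (\<Sum>z | z \<in> Gr i \<and> z \<subseteq> x. h z)"

definition down :: "nat \<Rightarrow> ('v set \<Rightarrow> real) \<Rightarrow> 'v set \<Rightarrow> real" where
  "down k f z = (\<Sum>x | x \<in> Gr k \<and> z \<subseteq> x. f x)"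

text \<open>With \<open>i - 1\<close> in place of \<open>Suc d = i\<close>, truncation would force
  \<open>h\<close> to vanish at level 0. In this form every function on level 0 is harmonic, so that
  level carries the constants.\<close>

definition harmonic :: "nat \<Rightarrow> ('v set \<Rightarrow> real) \<Rightarrow> bool" where
  "harmonic i h \<longleftrightarrow> (\<forall>d. Suc d = i \<longrightarrow> (\<forall>w\<in>Gr d. down i h w = 0))"

text \<open>At \<open>t = i\<close> this is the lift \<open>up i h x\<close>; at
  \<open>t = 0\<close> it is the sum over the spaces disjoint from \<open>x\<close>, which is what a
  disjointness matrix sees.\<close>

definition layer :: "nat \<Rightarrow> ('v set \<Rightarrow> real) \<Rightarrow> 'v set \<Rightarrow> nat \<Rightarrow> real" where
  "layer i h x t = (\<Sum>z | z \<in> Gr i \<and> dim (z \<inter> x) = t. h z)"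

definition inner_Gr :: "nat \<Rightarrow> ('v set \<Rightarrow> real) \<Rightarrow> ('v set \<Rightarrow> real) \<Rightarrow> real" where
  "inner_Gr d f g = (\<Sum>x\<in>Gr d. f x * g x)"

lemma up_same: "x \<in> Gr i \<Longrightarrow> up i h x = h x"
proof -
  assume "x \<in> Gr i"
  hence "{z. z \<in> Gr i \<and> z \<subseteq> x} = {x}" using Gr_eq by auto
  thus ?thesis by (simp add: up_def)
qed

text \<open>An \<open>i\<close>-space below \<open>x\<close> is reached once for every
  \<open>k\<close>-space between the two, and \<open>card_hyperplanes\<close> counts these.\<close>

lemma up_up:
  assumes "x \<in> Gr (Suc k)" "i \<le> k"
  shows "up k (up i h) x = e (Suc k - i) * up i h x"
proof -
  have "up k (up i h) x = (\<Sum>y\<in>{y \<in> Gr k. y \<subseteq> x}. \<Sum>z\<in>{z. z \<in> Gr i \<and> z \<subseteq> y}. h z)"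
    by (simp add: up_def)
  also have "\<dots> = (\<Sum>z\<in>Gr i. \<Sum>y\<in>{y. y \<in> {y \<in> Gr k. y \<subseteq> x} \<and> z \<subseteq> y}. h z)"
    by (rule sum.swap_restrict) auto
  also have "\<dots> = (\<Sum>z\<in>Gr i. if z \<subseteq> x then e (Suc k - i) * h z else 0)"
  proof (rule sum.cong)
    fix z assume z: "z \<in> Gr i"
    have *: "{y. y \<in> {y \<in> Gr k. y \<subseteq> x} \<and> z \<subseteq> y} = {y \<in> Gr k. z \<subseteq> y \<and> y \<subseteq> x}" by auto
    show "(\<Sum>y\<in>{y. y \<in> {y \<in> Gr k. y \<subseteq> x} \<and> z \<subseteq> y}. h z) =
        (if z \<subseteq> x then e (Suc k - i) * h z else 0)"
    proof (cases "z \<subseteq> x")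
      case True
      thus ?thesis
        unfolding * using card_hyperplanes[OF assms(1), of z] z assms(2) by (simp add: Gr_iff)
    next
      case False
      hence "{y \<in> Gr k. z \<subseteq> y \<and> y \<subseteq> x} = {}" by auto
      thus ?thesis unfolding * using False by (simp only: sum.empty if_False)
    qed
  qed simp
  also have "\<dots> = e (Suc k - i) * up i h x"
    by (simp add: up_def sum_distrib_left sum.inter_filter[symmetric])
  finally show ?thesis .
qed

lemma adjoint: "inner_Gr k f (up i h) = inner_Gr i (down k f) h"
proof -
  have "inner_Gr k f (up i h) = (\<Sum>x\<in>Gr k. \<Sum>z\<in>{z. z \<in> Gr i \<and> z \<subseteq> x}. f x * h z)"
    by (simp add: inner_Gr_def up_def sum_distrib_left)
  also have "\<dots> = (\<Sum>z\<in>Gr i. \<Sum>x\<in>{x. x \<in> Gr k \<and> z \<subseteq> x}. f x * h z)"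
    by (rule sum.swap_restrict) auto
  also have "\<dots> = inner_Gr i (down k f) h"
    by (simp add: inner_Gr_def down_def sum_distrib_right)
  finally show ?thesis .
qed

lemma inner_commute: "inner_Gr d f g = inner_Gr d g f"
  by (simp add: inner_Gr_def mult.commute)

lemma dim_inter_hyperplane:
  assumes "z \<in> Gr (Suc d)" "w \<in> Gr d" "w \<subseteq> z" "subspace x"
  shows "dim (z \<inter> x) \<le> Suc (dim (w \<inter> x))"
proof -
  have s: "subspace w" "subspace z" "dim w = d" "dim z = Suc d" "subspace (z \<inter> x)"
    using assms by (auto simp: Gr_iff subspace_inter)
  have "w \<inter> (z \<inter> x) = w \<inter> x" using assms(3) by auto
  moreover have "span (w \<union> (z \<inter> x)) \<subseteq> z" using assms(3) s by (intro span_minimal) auto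
  hence "dim (span (w \<union> (z \<inter> x))) \<le> Suc d" using dim_subset s(4) by metis
  ultimately show ?thesis using dim_join_meet[OF s(1,5)] s by simp
qed

text \<open>Replacing \<open>z\<close> by a hyperplane \<open>w\<close> of it keeps the dimension of
  the intersection with \<open>x\<close> exactly when \<open>w\<close> contains
  \<open>z \<inter> x\<close>, and lowers it by one otherwise.\<close>

lemma card_hyperplanes_meeting:
  assumes z: "z \<in> Gr (Suc d)" and x: "subspace x" and t: "t \<le> d"
  shows "real (card {w \<in> Gr d. dim (w \<inter> x) = t \<and> w \<subseteq> z}) =
    (if dim (z \<inter> x) = t then e (Suc d - t) else 0) +
    (if dim (z \<inter> x) = Suc t then Q ^ (d - t) * e (Suc t) else 0)"
proof -
  have sz: "subspace z" "dim z = Suc d" "subspace (z \<inter> x)" using z x by (auto simp: Gr_iff subspace_inter)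
  have keep: "dim (w \<inter> x) = dim (z \<inter> x) \<longleftrightarrow> z \<inter> x \<subseteq> w" if "w \<in> Gr d" "w \<subseteq> z" for w
  proof
    assume "dim (w \<inter> x) = dim (z \<inter> x)"
    moreover have "w \<inter> x \<subseteq> z \<inter> x" using that by auto
    ultimately have "w \<inter> x = z \<inter> x"
      using that x sz by (intro subspace_dim_equal) (auto simp: Gr_iff subspace_inter)
    thus "z \<inter> x \<subseteq> w" by auto
  next
    assume "z \<inter> x \<subseteq> w"
    hence "w \<inter> x = z \<inter> x" using that by auto
    thus "dim (w \<inter> x) = dim (z \<inter> x)" by simp
  qed
  have le: "dim (w \<inter> x) \<le> dim (z \<inter> x)" if "w \<subseteq> z" for w
    using that by (intro dim_subset) auto
  consider "dim (z \<inter> x) = t" | "dim (z \<inter> x) = Suc t" | "dim (z \<inter> x) \<noteq> t" "dim (z \<inter> x) \<noteq> Suc t"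
    by blast
  thus ?thesis
  proof cases
    case 1
    hence "{w \<in> Gr d. dim (w \<inter> x) = t \<and> w \<subseteq> z} = {w \<in> Gr d. z \<inter> x \<subseteq> w \<and> w \<subseteq> z}"
      using keep by auto
    thus ?thesis using card_hyperplanes[OF z sz(3)] 1 t by simp
  next
    case 2
    let ?A = "{w \<in> Gr d. {0} \<subseteq> w \<and> w \<subseteq> z}"
    let ?B = "{w \<in> ?A. z \<inter> x \<subseteq> w}"
    have "{w \<in> Gr d. dim (w \<inter> x) = t \<and> w \<subseteq> z} = ?A - ?B"
    proof (intro equalityI subsetI)
      fix w assume w: "w \<in> {w \<in> Gr d. dim (w \<inter> x) = t \<and> w \<subseteq> z}"
      hence "\<not> z \<inter> x \<subseteq> w" using keep[of w] 2 by auto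
      thus "w \<in> ?A - ?B" using w by (auto simp: Gr_iff subspace_0)
    next
      fix w assume w: "w \<in> ?A - ?B"
      hence "dim (w \<inter> x) \<noteq> dim (z \<inter> x)" using keep[of w] by auto
      moreover have "dim (z \<inter> x) \<le> Suc (dim (w \<inter> x))" using dim_inter_hyperplane[OF z _ _ x] w by auto
      ultimately show "w \<in> {w \<in> Gr d. dim (w \<inter> x) = t \<and> w \<subseteq> z}"
        using 2 le[of w] w by auto
    qed
    hence "real (card {w \<in> Gr d. dim (w \<inter> x) = t \<and> w \<subseteq> z}) = real (card ?A) - real (card ?B)"
      using real_card_Diff[of ?A ?B] by auto
    also have "real (card ?A) = e (Suc d)"
      using card_hyperplanes[OF z, of "{0}"] sz(1) by (auto simp: subspace_0)
    also have "real (card ?B) = e (d - t)"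
    \<comment> \<open>For \<open>t = d\<close> the space \<open>z \<inter> x\<close> is all of
      \<open>z\<close>, beyond the range of \<open>card_hyperplanes\<close>; no hyperplane contains
      it, in agreement with \<open>e 0 = 0\<close>.\<close>
    proof (cases "t = d")
      case True
      have "?B = {}"
      proof (intro equals0I)
        fix w assume "w \<in> ?B"
        hence "dim (z \<inter> x) \<le> dim w" "dim w = d" by (auto simp: Gr_iff intro!: dim_subset)
        thus False using True 2 by simp
      qed
      thus ?thesis using True by simp
    next
      case False
      have "?B = {w \<in> Gr d. z \<inter> x \<subseteq> w \<and> w \<subseteq> z}" by (auto simp: Gr_iff subspace_0)
      thus ?thesis using card_hyperplanes[OF z sz(3)] 2 t False by simp
    qed
    also have "e (Suc d) - e (d - t) = Q ^ (d - t) * e (Suc t)"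
      using t qnum_diff[of "d - t" "Suc d" Q] by simp
    finally show ?thesis using 2 by simp
  next
    case 3
    have "{w \<in> Gr d. dim (w \<inter> x) = t \<and> w \<subseteq> z} = {}"
    proof (intro equals0I)
      fix w assume w: "w \<in> {w \<in> Gr d. dim (w \<inter> x) = t \<and> w \<subseteq> z}"
      thus False using dim_inter_hyperplane[OF z _ _ x, of w] le[of w] 3 by auto
    qed
    thus ?thesis using 3 by (simp only: card.empty) simp
  qed
qed

text \<open>
  Harmonicity is summed over all \<open>d\<close>-spaces \<open>w\<close> with \<open>dim (w \<inter> x) = t\<close>: each of them is a hyperplane
  of \<open>(d + 1)\<close>-spaces that meet \<open>x\<close> in dimension \<open>t\<close> or \<open>t + 1\<close>.
\<close>

lemma layer_rec:
  assumes "harmonic (Suc d) h" "subspace x" "t \<le> d"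
  shows "e (Suc d - t) * layer (Suc d) h x t = - (Q ^ (d - t) * e (Suc t) * layer (Suc d) h x (Suc t))"
proof -
  let ?W = "{w \<in> Gr d. dim (w \<inter> x) = t}"
  have "0 = (\<Sum>w\<in>?W. \<Sum>z\<in>{z. z \<in> Gr (Suc d) \<and> w \<subseteq> z}. h z)"
    using assms(1) by (simp add: harmonic_def down_def)
  also have "\<dots> = (\<Sum>z\<in>Gr (Suc d). \<Sum>w\<in>{w. w \<in> ?W \<and> w \<subseteq> z}. h z)"
    by (rule sum.swap_restrict) auto
  also have "\<dots> = (\<Sum>z\<in>Gr (Suc d). real (card {w \<in> Gr d. dim (w \<inter> x) = t \<and> w \<subseteq> z}) * h z)"
    by (simp add: conj_assoc)
  also have "\<dots> = (\<Sum>z\<in>Gr (Suc d). (if dim (z \<inter> x) = t then e (Suc d - t) * h z else 0) +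
      (if dim (z \<inter> x) = Suc t then Q ^ (d - t) * e (Suc t) * h z else 0))"
    by (rule sum.cong) (simp_all add: card_hyperplanes_meeting[OF _ assms(2,3)])
  also have "\<dots> = e (Suc d - t) * layer (Suc d) h x t + Q ^ (d - t) * e (Suc t) * layer (Suc d) h x (Suc t)"
    by (simp add: sum.distrib layer_def sum_distrib_left sum.inter_filter[symmetric])
  finally show ?thesis by simp
qed

lemma layer_top:
  assumes "subspace x"
  shows "layer i h x i = up i h x"
proof -
  have "dim (z \<inter> x) = i \<longleftrightarrow> z \<subseteq> x" if z: "z \<in> Gr i" for z
  proof
    assume "dim (z \<inter> x) = i"
    hence "z \<inter> x = z" using z assms by (intro subspace_dim_equal) (auto simp: Gr_iff subspace_inter)
    thus "z \<subseteq> x" by auto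
  next
    assume "z \<subseteq> x"
    thus "dim (z \<inter> x) = i" using z by (simp add: Gr_iff inf.absorb1)
  qed
  thus ?thesis unfolding layer_def up_def by (intro sum.cong) auto
qed

text \<open>Running \<open>layer_rec\<close> from the top layer down to layer 0 collects the factors
  \<open>- (Q ^ s)\<close>. The q-numbers gathered on either side multiply to the q-factorial of
  \<open>i\<close> and cancel.\<close>

lemma layer_bottom:
  assumes "harmonic i h" "subspace x"
  shows "layer i h x 0 = eps i * up i h x"
proof -
  \<comment> \<open>\<open>m\<close> counts the layers below the top; the denominators are kept on
    the left to avoid division.\<close>
  have "m \<le> i \<Longrightarrow> (\<Prod>s<m. e (Suc s)) * layer i h x (i - m) = eps m * (\<Prod>s<m. e (i - s)) * up i h x" for m
  proof (induction m)
    case 0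
    thus ?case using assms(2) by (simp add: qsign_def layer_top)
  next
    case (Suc m)
    obtain d where d: "i = Suc d" using Suc.prems by (cases i) auto
    have eq: "e (Suc m) * layer i h x (i - Suc m) = - (Q ^ m * e (i - m) * layer i h x (i - m))"
      using layer_rec[of d h x "d - m"] assms Suc.prems d by (simp add: Suc_diff_le)
    have "(\<Prod>s<Suc m. e (Suc s)) * layer i h x (i - Suc m) =
      (\<Prod>s<m. e (Suc s)) * (e (Suc m) * layer i h x (i - Suc m))"
      by simp
    also have "\<dots> = (\<Prod>s<m. e (Suc s)) * - (Q ^ m * e (i - m) * layer i h x (i - m))"
      by (simp only: eq)
    also have "\<dots> = - (Q ^ m) * e (i - m) * ((\<Prod>s<m. e (Suc s)) * layer i h x (i - m))"
      by (simp only: mult_ac mult_minus_left mult_minus_right)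
    also have "\<dots> = - (Q ^ m) * e (i - m) * (eps m * (\<Prod>s<m. e (i - s)) * up i h x)"
      using Suc by simp
    also have "\<dots> = eps (Suc m) * (\<Prod>s<Suc m. e (i - s)) * up i h x"
      by (simp add: qsign_def)
    finally show ?case .
  qed
  from this[of i] have "(\<Prod>s<i. e (Suc s)) * layer i h x 0 = eps i * (\<Prod>s<i. e (i - s)) * up i h x" by simp
  moreover have "(\<Prod>s<i. e (i - s)) = (\<Prod>s<i. e (Suc s))"
    using prod.nat_diff_reindex[of "\<lambda>s. e (Suc s)" i] by (simp add: Suc_diff_Suc)
  moreover have "(\<Prod>s<i. e (Suc s)) \<noteq> 0"
    using e_pos by (simp add: less_imp_neq[symmetric])
  ultimately show ?thesis by simp
qed

section \<open>Eigenvalues and norms of lifts\<close>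

lemma card_common_covers:
  assumes x: "x \<in> Gr k" and z: "z \<in> Gr i"
  shows "real (card {y \<in> Gr (Suc k). x \<subseteq> y \<and> z \<subseteq> y}) =
    (if dim (z \<inter> x) = i then e (n - k) else 0) + (if Suc (dim (z \<inter> x)) = i then 1 else 0)"
proof -
  have s: "subspace x" "subspace z" "dim x = k" "dim z = i" using x z by (auto simp: Gr_iff)
  have join: "dim (span (z \<union> x)) + dim (z \<inter> x) = i + k" using dim_join_meet[OF s(2,1)] s by simp
  have le: "dim (z \<inter> x) \<le> i" using dim_subset[of "z \<inter> x" z] s by simp
  have sub: "span (z \<union> x) \<subseteq> y" if "y \<in> Gr (Suc k)" "x \<subseteq> y" "z \<subseteq> y" for y
    using that by (intro span_minimal) (auto simp: Gr_iff)
  consider "dim (z \<inter> x) = i" | "Suc (dim (z \<inter> x)) = i" | "dim (z \<inter> x) \<noteq> i" "Suc (dim (z \<inter> x)) \<noteq> i"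
    by blast
  thus ?thesis
  proof cases
    case 1
    hence "z \<inter> x = z" using s by (intro subspace_dim_equal) (auto simp: subspace_inter)
    hence "{y \<in> Gr (Suc k). x \<subseteq> y \<and> z \<subseteq> y} = {y \<in> Gr (Suc (dim x)). x \<subseteq> y \<and> y \<subseteq> UNIV}"
      using s by auto
    thus ?thesis using card_covers[OF s(1) subspace_UNIV] s 1 by simp
  next
    case 2
    hence j: "span (z \<union> x) \<in> Gr (Suc k)" using join by (simp add: Gr_iff del: dim_span)
    have "{y \<in> Gr (Suc k). x \<subseteq> y \<and> z \<subseteq> y} = {span (z \<union> x)}"
    proof (intro equalityI subsetI)
      fix y assume "y \<in> {y \<in> Gr (Suc k). x \<subseteq> y \<and> z \<subseteq> y}"
      thus "y \<in> {span (z \<union> x)}" using Gr_eq[OF j, of y] sub[of y] by simp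
    next
      fix y assume "y \<in> {span (z \<union> x)}"
      thus "y \<in> {y \<in> Gr (Suc k). x \<subseteq> y \<and> z \<subseteq> y}" using j span_superset[of "z \<union> x"] by auto
    qed
    thus ?thesis using 2 by simp
  next
    case 3
    have "{y \<in> Gr (Suc k). x \<subseteq> y \<and> z \<subseteq> y} = {}"
    proof (intro equals0I)
      fix y assume "y \<in> {y \<in> Gr (Suc k). x \<subseteq> y \<and> z \<subseteq> y}"
      hence "dim (span (z \<union> x)) \<le> Suc k" using dim_subset[OF sub[of y]] by (auto simp: Gr_iff)
      thus False using join le 3 by linarith
    qed
    thus ?thesis using 3 by (simp only: card.empty) simp
  qed
qed

text \<open>An \<open>i\<close>-space inside \<open>x\<close> is counted [n-k] times, one that meets
  \<open>x\<close> in codimension 1 once, any other never. The lowest step of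
  \<open>layer_rec\<close> turns the second sum into -[i] times the lift, and [n-k] - [i] = q^i
  [n-k-i].\<close>

lemma down_up_harmonic:
  assumes "harmonic i h" "x \<in> Gr k" "k + i \<le> n"
  shows "down (Suc k) (up i h) x = Q ^ i * e (n - k - i) * up i h x"
proof -
  have sx: "subspace x" using assms(2) by (simp add: Gr_iff)
  have "down (Suc k) (up i h) x =
      (\<Sum>y\<in>{y \<in> Gr (Suc k). x \<subseteq> y}. \<Sum>z\<in>{z. z \<in> Gr i \<and> z \<subseteq> y}. h z)"
    by (simp add: down_def up_def)
  also have "\<dots> = (\<Sum>z\<in>Gr i. \<Sum>y\<in>{y. y \<in> {y \<in> Gr (Suc k). x \<subseteq> y} \<and> z \<subseteq> y}. h z)"
    by (rule sum.swap_restrict) auto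
  also have "\<dots> = (\<Sum>z\<in>Gr i. real (card {y \<in> Gr (Suc k). x \<subseteq> y \<and> z \<subseteq> y}) * h z)"
    by (simp add: conj_assoc)
  also have "\<dots> = (\<Sum>z\<in>Gr i. (if dim (z \<inter> x) = i then e (n - k) * h z else 0) +
      (if Suc (dim (z \<inter> x)) = i then h z else 0))"
    by (rule sum.cong) (simp_all add: card_common_covers[OF assms(2)])
  also have "\<dots> = e (n - k) * up i h x + (\<Sum>z\<in>Gr i. if Suc (dim (z \<inter> x)) = i then h z else 0)"
    by (simp add: sum.distrib layer_top[OF sx, symmetric] layer_def sum_distrib_left sum.inter_filter[symmetric])
  also have "(\<Sum>z\<in>Gr i. if Suc (dim (z \<inter> x)) = i then h z else 0) = - e i * up i h x"
  proof (cases i)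
    case (Suc d)
    have "(\<Sum>z\<in>Gr i. if Suc (dim (z \<inter> x)) = i then h z else 0) = layer (Suc d) h x d"
      using Suc by (simp add: layer_def sum.inter_filter[symmetric])
    also have "\<dots> = - e i * up i h x"
      using layer_rec[of d h x d] assms(1) sx Suc by (simp add: layer_top)
    finally show ?thesis .
  qed simp
  also have "e (n - k) = e i + Q ^ i * e (n - k - i)"
    using assms(3) by (intro qnum_diff) simp
  finally show ?thesis by (simp add: algebra_simps)
qed

lemma norm_factor_Suc:
  assumes "i \<le> k" "k + i < n"
  shows "norm_factor Q n i (Suc k) * e (Suc k - i) = Q ^ i * e (n - k - i) * norm_factor Q n i k"
proof -
  have idx: "Suc k - i = Suc (k - i)" "(n - 2 * i) - (k - i) = n - k - i" using assms by auto
  have "norm_factor Q n i (Suc k) * e (Suc k - i) =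
      Q ^ i * Q ^ (i * (k - i)) * (qbinom Q (n - 2 * i) (Suc (k - i)) * e (Suc (k - i)))"
    by (simp only: norm_factor_def idx(1) mult_Suc_right power_add mult.assoc)
  also have "\<dots> = Q ^ i * Q ^ (i * (k - i)) * (qbinom Q (n - 2 * i) (k - i) * e (n - k - i))"
    by (simp only: qbinom_Suc[OF Q_pos] idx(2))
  finally show ?thesis by (simp only: norm_factor_def mult_ac)
qed

text \<open>By \<open>up_up\<close> a lift from below passes through level \<open>j - 1\<close>;
  moving that last lift to the other side applies \<open>down j\<close> to \<open>g\<close>, which
  gives 0.\<close>

lemma inner_up_same_level:
  assumes "harmonic j g" "i < j"
  shows "inner_Gr j (up i h) g = 0"
proof -
  obtain d where d: "j = Suc d" using assms(2) by (cases j) auto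
  have "e (j - i) * inner_Gr j (up i h) g = inner_Gr j (up d (up i h)) g"
    using assms(2) d by (auto simp: inner_Gr_def up_up sum_distrib_left mult.assoc intro!: sum.cong)
  also have "\<dots> = inner_Gr d (down j g) (up i h)"
    by (subst inner_commute) (rule adjoint)
  also have "\<dots> = 0" using assms(1) d by (simp add: inner_Gr_def harmonic_def)
  finally show ?thesis using e_pos[of "j - i"] assms(2) by simp
qed

text \<open>Induction on \<open>k\<close> from the larger level. One lift on the right moves to the
  left as \<open>down\<close>, where \<open>down_up_harmonic\<close> makes it a scalar;
  \<open>norm_factor_Suc\<close> matches the scalars.\<close>

lemma inner_up_up:
  assumes "harmonic i h" "harmonic j g" "i \<le> k" "j \<le> k" "2 * k \<le> n"
  shows "inner_Gr k (up i h) (up j g) = (if i = j then norm_factor Q n i k * inner_Gr i h g else 0)"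
proof -
  have "max i j \<le> k" using assms by simp
  thus ?thesis using assms(5)
  proof (induction k rule: dec_induct)
    case base
    have eq: "inner_Gr d (up d f) f' = inner_Gr d f f'" "inner_Gr d f' (up d f) = inner_Gr d f' f" for d f f'
      by (auto simp: inner_Gr_def up_same intro: sum.cong)
    consider "i < j" | "i = j" | "j < i" by linarith
    thus ?case
    proof cases
      case 1
      thus ?thesis using inner_up_same_level[OF assms(2) 1] by (simp add: eq max_def)
    next
      case 2
      thus ?thesis by (simp add: eq norm_factor_def)
    next
      case 3
      thus ?thesis using inner_up_same_level[OF assms(1) 3] by (simp add: eq max_def inner_commute[of _ h])
    qed
  next
    case (step k)
    have "e (Suc k - j) * inner_Gr (Suc k) (up i h) (up j g) = inner_Gr (Suc k) (up i h) (up k (up j g))"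
      using step by (auto simp: inner_Gr_def up_up sum_distrib_left intro!: sum.cong)
    also have "\<dots> = inner_Gr k (down (Suc k) (up i h)) (up j g)" by (rule adjoint)
    also have "\<dots> = Q ^ i * e (n - k - i) * inner_Gr k (up i h) (up j g)"
      using step.hyps step.prems assms(1)
      by (auto simp: inner_Gr_def down_up_harmonic sum_distrib_left mult.assoc intro!: sum.cong)
    also have "\<dots> = (if i = j then e (Suc k - j) * norm_factor Q n i (Suc k) * inner_Gr i h g else 0)"
      using step norm_factor_Suc[of i k] by (auto simp: mult_ac)
    finally show ?case using e_pos[of "Suc k - j"] step by auto
  qed
qed

section \<open>Decomposition into harmonic components\<close>

lemma up_scale: "up i (\<lambda>z. c * h z) x = c * up i h x"
  by (simp add: up_def sum_distrib_left)

lemma down_scale: "down i (\<lambda>z. c * h z) x = c * down i h x"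
  by (simp add: down_def sum_distrib_left)

lemma harmonic_scale: "harmonic i h \<Longrightarrow> harmonic i (\<lambda>z. c * h z)"
  by (simp add: harmonic_def down_scale)

lemma down_sum: "down k (\<lambda>x. \<Sum>i\<in>I. f i x) z = (\<Sum>i\<in>I. down k (f i) z)"
  unfolding down_def by (rule sum.swap)

text \<open>Decompose \<open>down (Suc k) f\<close> one level lower, divide each component by its
  down-up eigenvalue and lift again. The result \<open>g\<close> has the same \<open>down\<close> as
  \<open>f\<close>, so \<open>f - g\<close> is harmonic and serves as the top component.\<close>

lemma harmonic_decomposition:
  assumes "2 * k \<le> n"
  shows "\<exists>h. (\<forall>i\<le>k. harmonic i (h i)) \<and> (\<forall>x\<in>Gr k. f x = (\<Sum>i\<le>k. up i (h i) x))"
  using assms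
proof (induction k arbitrary: f)
  case 0
  have "harmonic 0 f" by (simp add: harmonic_def)
  thus ?case by (intro exI[of _ "\<lambda>_. f"]) (simp add: up_same)
next
  case (Suc k)
  have "2 * k \<le> n" using Suc.prems by simp
  then obtain h where h: "\<And>i. i \<le> k \<Longrightarrow> harmonic i (h i)"
    and dec: "\<And>x. x \<in> Gr k \<Longrightarrow> down (Suc k) f x = (\<Sum>i\<le>k. up i (h i) x)"
    using Suc.IH[of "down (Suc k) f"] by blast
  define h' where "h' = (\<lambda>i z. inverse (Q ^ i * e (n - k - i)) * h i z)"
  define g where "g = (\<lambda>x. \<Sum>i\<le>k. up i (h' i) x)"
  have h': "harmonic i (h' i)" if "i \<le> k" for i
    unfolding h'_def using h[OF that] by (rule harmonic_scale)
  have "down (Suc k) g x = down (Suc k) f x" if x: "x \<in> Gr k" for x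
  proof -
    have "down (Suc k) g x = (\<Sum>i\<le>k. down (Suc k) (up i (h' i)) x)"
      by (simp add: g_def down_sum)
    also have "\<dots> = (\<Sum>i\<le>k. up i (h i) x)"
    proof (rule sum.cong)
      fix i assume i: "i \<in> {..k}"
      have "e (n - k - i) > 0" using i Suc.prems by (intro e_pos) auto
      hence "Q ^ i * e (n - k - i) \<noteq> 0" using Q_pos by simp
      moreover have "down (Suc k) (up i (h' i)) x = Q ^ i * e (n - k - i) * up i (h' i) x"
        using i Suc.prems x h'[of i] by (intro down_up_harmonic) auto
      moreover have "up i (h' i) x = inverse (Q ^ i * e (n - k - i)) * up i (h i) x"
        unfolding h'_def by (rule up_scale)
      ultimately show "down (Suc k) (up i (h' i)) x = up i (h i) x"
        by (metis mult.assoc mult.left_neutral right_inverse)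
    qed simp
    finally show ?thesis using dec[OF x] by simp
  qed
  hence top: "harmonic (Suc k) (\<lambda>x. f x - g x)"
    by (simp add: harmonic_def down_def sum_subtractf)
  show ?case
  proof (intro exI[of _ "h'(Suc k := \<lambda>x. f x - g x)"] conjI allI impI ballI)
    fix i assume "i \<le> Suc k"
    thus "harmonic i ((h'(Suc k := \<lambda>x. f x - g x)) i)" using h'[of i] top by (auto simp: le_Suc_eq)
  next
    fix x assume x: "x \<in> Gr (Suc k)"
    have "(\<Sum>i\<le>Suc k. up i ((h'(Suc k := \<lambda>x. f x - g x)) i) x) = g x + up (Suc k) (\<lambda>x. f x - g x) x"
      by (simp add: g_def)
    thus "f x = (\<Sum>i\<le>Suc k. up i ((h'(Suc k := \<lambda>x. f x - g x)) i) x)"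
      using x by (simp add: up_same)
  qed
qed

section \<open>Disjointness matrices on lifts\<close>

lemma cover_meets_trivially_iff:
  assumes y: "subspace y" and x: "subspace x" and yx: "y \<inter> x = {0}"
    and y': "y' \<in> Gr (Suc (dim y))" "y \<subseteq> y'"
  shows "y' \<inter> x = {0} \<longleftrightarrow> \<not> y' \<subseteq> span (y \<union> x)"
proof
  assume t: "y' \<inter> x = {0}"
  have "y \<noteq> y'" using y'(1) by (auto simp: Gr_iff)
  then obtain v where v: "v \<in> y'" "v \<notin> y" using y'(2) by auto
  show "\<not> y' \<subseteq> span (y \<union> x)"
  proof
    assume "y' \<subseteq> span (y \<union> x)"
    then obtain a b where ab: "a \<in> y" "b \<in> x" "v = a + b" using v x y by (auto simp: span_Un)
    have "b = v - a" using ab by simp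
    moreover have "v - a \<in> y'" using v ab y' by (intro subspace_diff) (auto simp: Gr_iff)
    ultimately have "b \<in> y'" by simp
    hence "b = 0" using t ab by auto
    thus False using ab v by simp
  qed
next
  assume not_sub: "\<not> y' \<subseteq> span (y \<union> x)"
  have "v = 0" if v: "v \<in> y'" "v \<in> x" for v
  proof (rule ccontr)
    assume "v \<noteq> 0"
    hence "v \<notin> y" using v yx by auto
    hence "y' = span (insert v y)" using y' y v by (intro cover_eq_span_insert) auto
    also have "\<dots> \<subseteq> span (y \<union> x)" using v by (intro span_mono) auto
    finally show False using not_sub by simp
  qed
  thus "y' \<inter> x = {0}" using x y' by (auto simp: Gr_iff subspace_0)
qed

lemma opp_count_Suc:
  assumes "i \<le> l" "k + l < n"
  shows "opp_count Q n i (Suc l) k * e (Suc l - i) = Q ^ k * e (n - k - l) * opp_count Q n i l k"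
proof -
  have idx: "Suc l - i = Suc (l - i)" "(n - k - i) - (l - i) = n - k - l" using assms by auto
  have "opp_count Q n i (Suc l) k * e (Suc l - i) =
      Q ^ k * Q ^ (k * (l - i)) * (qbinom Q (n - k - i) (Suc (l - i)) * e (Suc (l - i)))"
    by (simp only: opp_count_def idx(1) mult_Suc_right power_add mult.assoc)
  also have "\<dots> = Q ^ k * Q ^ (k * (l - i)) * (qbinom Q (n - k - i) (l - i) * e (n - k - l))"
    by (simp only: qbinom_Suc[OF Q_pos] idx(2))
  finally show ?thesis by (simp only: opp_count_def mult_ac)
qed

text \<open>Induction on \<open>l\<close> by counting pairs of \<open>y\<close> and a cover
  \<open>y'\<close>. The admissible covers of \<open>y\<close> are those not inside
  \<open>span (y \<union> x)\<close>, hence a difference of two cover counts; conversely every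
  hyperplane of \<open>y'\<close> through \<open>z\<close> inherits disjointness from
  \<open>x\<close>.\<close>

lemma card_opposite:
  assumes z: "z \<in> Gr i" and x: "x \<in> Gr k" and zx: "z \<inter> x = {0}" and "i \<le> l" "k + l \<le> n"
  shows "real (card {y \<in> Gr l. z \<subseteq> y \<and> y \<inter> x = {0}}) = opp_count Q n i l k"
  using assms(4,5)
proof (induction l rule: dec_induct)
  case base
  have "{y \<in> Gr i. z \<subseteq> y \<and> y \<inter> x = {0}} = {z}" using z zx Gr_eq[OF z] by auto
  thus ?case by (simp add: opp_count_def)
next
  case (step l)
  let ?A = "{y \<in> Gr l. z \<subseteq> y \<and> y \<inter> x = {0}}"
  let ?B = "{y \<in> Gr (Suc l). z \<subseteq> y \<and> y \<inter> x = {0}}"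
  have s: "subspace x" "dim x = k" "subspace z" "dim z = i" using x z by (auto simp: Gr_iff)
  have 1: "real (card {y' \<in> ?B. y \<subseteq> y'}) = Q ^ k * e (n - k - l)" if "y \<in> ?A" for y
  proof -
    have y: "subspace y" "dim y = l" "z \<subseteq> y" "y \<inter> x = {0}" using that by (simp_all add: Gr_iff)
    let ?cov = "\<lambda>s. {y' \<in> Gr (Suc l). y \<subseteq> y' \<and> y' \<subseteq> s}"
    have iff: "y' \<inter> x = {0} \<longleftrightarrow> \<not> y' \<subseteq> span (y \<union> x)" if "y' \<in> Gr (Suc l)" "y \<subseteq> y'" for y'
      using cover_meets_trivially_iff[OF y(1) s(1) y(4)] that by (simp only: y(2))
    have "{y' \<in> ?B. y \<subseteq> y'} = ?cov UNIV - ?cov (span (y \<union> x))"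
      using iff y(3) by (intro set_eqI) (simp, meson order_trans)
    hence "real (card {y' \<in> ?B. y \<subseteq> y'}) = real (card (?cov UNIV - ?cov (span (y \<union> x))))"
      by (simp only:)
    also have "\<dots> = real (card (?cov UNIV)) - real (card (?cov (span (y \<union> x))))"
      by (intro real_card_Diff finite_sets) blast
    also have "real (card (?cov UNIV)) = e (n - dim y)"
      using card_covers[OF y(1) subspace_UNIV] by (simp only: y(2) subset_UNIV simp_thms)
    also have "real (card (?cov (span (y \<union> x)))) = e (dim (span (y \<union> x)) - dim y)"
      using card_covers[OF y(1) subspace_span, of "y \<union> x"] span_superset[of "y \<union> x"]
      by (simp only: y(2) Un_subset_iff simp_thms)
    also have "dim (span (y \<union> x)) = l + k"
      using dim_join_meet[OF y(1) s(1)] by (simp add: y(2,4) s(2))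
    also have "e (n - dim y) - e (l + k - dim y) = Q ^ k * e (n - k - l)"
    proof -
      have "n - l - k = n - k - l" "l + k - dim y = k" "n - dim y = n - l" using y(2) by auto
      moreover have "e (n - l) = e k + Q ^ k * e (n - l - k)"
        using step.prems by (intro qnum_diff) linarith
      ultimately show ?thesis by (simp only:)
    qed
    finally show ?thesis .
  qed
  have 2: "real (card {y \<in> ?A. y \<subseteq> y'}) = e (Suc l - i)" if "y' \<in> ?B" for y'
  proof -
    have y': "y' \<in> Gr (Suc l)" "z \<subseteq> y'" "y' \<inter> x = {0}" using that by auto
    have "{y \<in> ?A. y \<subseteq> y'} = {y \<in> Gr l. z \<subseteq> y \<and> y \<subseteq> y'}"
      using y' s subspace_0 by (auto simp: Gr_iff)
    thus ?thesis using card_hyperplanes[OF y'(1) s(3) y'(2)] step.hyps s by simp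
  qed
  have "real (card ?A) * (Q ^ k * e (n - k - l)) = real (card ?B) * e (Suc l - i)"
    using double_count[of ?A ?B "\<lambda>y y'. y \<subseteq> y'"] 1 2 by simp
  moreover have "real (card ?A) = opp_count Q n i l k" using step by simp
  moreover have "opp_count Q n i (Suc l) k * e (Suc l - i) = Q ^ k * e (n - k - l) * opp_count Q n i l k"
    using step by (intro opp_count_Suc) auto
  ultimately have "real (card ?B) * e (Suc l - i) = opp_count Q n i (Suc l) k * e (Suc l - i)"
    by (metis mult.commute)
  moreover have "e (Suc l - i) > 0" using step by (intro e_pos) simp
  ultimately show ?case by simp
qed

text \<open>The action of \<open>W_bar\<close> on a function. The dimension of \<open>x\<close> is
  left open, so one operator serves the rows in \<open>Gr k\<close> and those in
  \<open>Gr l\<close>.\<close>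

definition opp :: "nat \<Rightarrow> ('v set \<Rightarrow> real) \<Rightarrow> 'v set \<Rightarrow> real" where
  "opp l g x = (\<Sum>y | y \<in> Gr l \<and> x \<inter> y = {0}. g y)"

text \<open>After exchanging sums, an \<open>i\<close>-space disjoint from \<open>x\<close> is
  counted \<open>opp_count\<close> times and any other never. What remains is the bottom layer, a
  multiple of the lift.\<close>

lemma opp_up_harmonic:
  assumes "harmonic i h" "x \<in> Gr k" "i \<le> l" "k + l \<le> n"
  shows "opp l (up i h) x = opp_count Q n i l k * eps i * up i h x"
proof -
  have sx: "subspace x" using assms(2) by (simp add: Gr_iff)
  have "opp l (up i h) x = (\<Sum>y\<in>{y \<in> Gr l. x \<inter> y = {0}}. \<Sum>z\<in>{z. z \<in> Gr i \<and> z \<subseteq> y}. h z)"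
    by (simp add: opp_def up_def)
  also have "\<dots> = (\<Sum>z\<in>Gr i. \<Sum>y\<in>{y. y \<in> {y \<in> Gr l. x \<inter> y = {0}} \<and> z \<subseteq> y}. h z)"
    by (rule sum.swap_restrict) auto
  also have "\<dots> = (\<Sum>z\<in>Gr i. if dim (z \<inter> x) = 0 then opp_count Q n i l k * h z else 0)"
  proof (rule sum.cong)
    fix z assume z: "z \<in> Gr i"
    hence sz: "subspace z" by (simp add: Gr_iff)
    have iff: "dim (z \<inter> x) = 0 \<longleftrightarrow> z \<inter> x = {0}" using subspace_0[OF sz] subspace_0[OF sx] by auto
    have eq: "{y. y \<in> {y \<in> Gr l. x \<inter> y = {0}} \<and> z \<subseteq> y} = {y \<in> Gr l. z \<subseteq> y \<and> y \<inter> x = {0}}" by auto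
    show "(\<Sum>y\<in>{y. y \<in> {y \<in> Gr l. x \<inter> y = {0}} \<and> z \<subseteq> y}. h z) =
        (if dim (z \<inter> x) = 0 then opp_count Q n i l k * h z else 0)"
    proof (cases "z \<inter> x = {0}")
      case True
      thus ?thesis unfolding eq iff using card_opposite[OF z assms(2) True assms(3,4)] by simp
    next
      case False
      have "{y \<in> Gr l. z \<subseteq> y \<and> y \<inter> x = {0}} = {}"
        using False subspace_0[OF sz] subspace_0[OF sx] by auto
      thus ?thesis unfolding eq iff using False by (simp only: sum.empty if_False)
    qed
  qed simp
  also have "\<dots> = opp_count Q n i l k * layer i h x 0"
    by (simp add: layer_def sum_distrib_left sum.inter_filter[symmetric] del: dim_eq_0)
  also have "layer i h x 0 = eps i * up i h x" by (rule layer_bottom[OF assms(1) sx])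
  finally show ?thesis by simp
qed

end

section \<open>The quadratic form\<close>

text \<open>Complete the square after multiplying by \<open>A\<close>; for \<open>A = 0\<close> the
  determinant condition forces \<open>E = 0\<close>.\<close>

lemma psd_block:
  fixes A D E p r :: real
  assumes "0 \<le> A" "0 \<le> D" "E\<^sup>2 \<le> A * D"
  shows "0 \<le> A * p\<^sup>2 + D * r\<^sup>2 - 2 * E * (p * r)"
proof (cases "A = 0")
  case True
  hence "E = 0" using assms(3) by simp
  thus ?thesis using True assms by simp
next
  case False
  hence A: "A > 0" using assms(1) by simp
  have "A * (A * p\<^sup>2 + D * r\<^sup>2 - 2 * E * (p * r)) = (A * p - E * r)\<^sup>2 + (A * D - E\<^sup>2) * r\<^sup>2"
    by (simp add: power2_eq_square algebra_simps)
  also have "\<dots> \<ge> 0" using assms by simp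
  finally show ?thesis using A by (simp add: zero_le_mult_iff)
qed

context finite_field_space
begin

lemma inner_sum_left: "inner_Gr k (\<lambda>x. \<Sum>i\<in>I. f i x) g = (\<Sum>i\<in>I. inner_Gr k (f i) g)"
  unfolding inner_Gr_def sum_distrib_right by (rule sum.swap)

lemma inner_sum_right: "inner_Gr k f (\<lambda>x. \<Sum>i\<in>I. g i x) = (\<Sum>i\<in>I. inner_Gr k f (g i))"
  unfolding inner_Gr_def sum_distrib_left by (rule sum.swap)

lemma inner_cong:
  "(\<And>x. x \<in> Gr k \<Longrightarrow> f x = f' x) \<Longrightarrow> (\<And>x. x \<in> Gr k \<Longrightarrow> g x = g' x) \<Longrightarrow> inner_Gr k f g = inner_Gr k f' g'"
  unfolding inner_Gr_def by (rule sum.cong) auto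

lemma inner_scale_right: "inner_Gr k f (\<lambda>x. c * g x) = c * inner_Gr k f g"
  by (simp add: inner_Gr_def sum_distrib_left mult_ac)

lemma opp_sum: "opp l (\<lambda>x. \<Sum>i\<in>I. f i x) z = (\<Sum>i\<in>I. opp l (f i) z)"
  unfolding opp_def by (rule sum.swap)

lemma opp_cong: "(\<And>x. x \<in> Gr l \<Longrightarrow> f x = f' x) \<Longrightarrow> opp l f z = opp l f' z"
  unfolding opp_def by (rule sum.cong) auto

text \<open>Parseval for the harmonic decomposition. The second function may have fewer levels and
  carries scalars, so that \<open>u\<close> itself, its images under \<open>opp\<close> and the
  constant function are all covered.\<close>

lemma inner_decomposed:
  assumes f: "\<And>i. i \<le> k \<Longrightarrow> harmonic i (f i)" and g: "\<And>i. i \<le> m \<Longrightarrow> harmonic i (g i)"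
    and "m \<le> k" "2 * k \<le> n"
    and v: "\<And>x. x \<in> Gr k \<Longrightarrow> v x = (\<Sum>i\<le>k. up i (f i) x)"
    and w: "\<And>x. x \<in> Gr k \<Longrightarrow> w x = (\<Sum>j\<le>m. c j * up j (g j) x)"
  shows "inner_Gr k v w = (\<Sum>i\<le>m. c i * norm_factor Q n i k * inner_Gr i (f i) (g i))"
proof -
  have "inner_Gr k v w = inner_Gr k (\<lambda>x. \<Sum>i\<le>k. up i (f i) x) (\<lambda>x. \<Sum>j\<le>m. c j * up j (g j) x)"
    using v w by (rule inner_cong)
  also have "\<dots> = (\<Sum>j\<le>m. \<Sum>i\<le>k. c j * inner_Gr k (up i (f i)) (up j (g j)))"
    by (subst inner_sum_right) (simp add: inner_scale_right inner_sum_left sum_distrib_left)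
  also have "\<dots> = (\<Sum>j\<le>m. \<Sum>i\<le>k. if i = j then c j * norm_factor Q n j k * inner_Gr j (f j) (g j) else 0)"
    using assms by (intro sum.cong refl) (auto simp: inner_up_up)
  also have "\<dots> = (\<Sum>i\<le>m. c i * norm_factor Q n i k * inner_Gr i (f i) (g i))"
    using assms by (intro sum.cong refl) (auto simp: sum.delta)
  finally show ?thesis .
qed

text \<open>Level \<open>i\<close> contributes a form in the components \<open>f i\<close> and
  \<open>g i\<close> of \<open>u\<close> on the \<open>k\<close>- and \<open>l\<close>-spaces; above
  level \<open>l\<close> only \<open>f i\<close> is left. The all-ones part sees level 0 alone,
  hence the case distinction in \<open>det\<close>, with 1/2 because the cross term enters
  doubled.\<close>

lemma quadratic_form_nonneg:
  assumes kl: "l \<le> k" "2 * k \<le> n"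
    and single: "\<And>i. l < i \<Longrightarrow> i \<le> k \<Longrightarrow> 0 \<le> \<alpha> - a * (opp_count Q n i k k * eps i)"
    and blk1: "\<And>i. i \<le> l \<Longrightarrow> 0 \<le> \<alpha> - a * (opp_count Q n i k k * eps i)"
    and blk2: "\<And>i. i \<le> l \<Longrightarrow> 0 \<le> \<alpha> - c * (opp_count Q n i l l * eps i)"
    and det: "\<And>i. i \<le> l \<Longrightarrow>
      (b * (opp_count Q n i l k * eps i) * norm_factor Q n i k
        + (if i = 0 then norm_factor Q n 0 k * norm_factor Q n 0 l / 2 else 0))\<^sup>2 \<le>
      (\<alpha> - a * (opp_count Q n i k k * eps i)) * norm_factor Q n i k *
      ((\<alpha> - c * (opp_count Q n i l l * eps i)) * norm_factor Q n i l)"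
  shows "0 \<le> \<alpha> * inner_Gr k u u + \<alpha> * inner_Gr l u u - (\<Sum>x\<in>Gr k. u x) * (\<Sum>y\<in>Gr l. u y)
    - 2 * b * inner_Gr k u (opp l u) - a * inner_Gr k u (opp k u) - c * inner_Gr l u (opp l u)"
proof -
  have kl': "2 * l \<le> n" "k + l \<le> n" using kl by auto
  obtain f where hf: "\<And>i. i \<le> k \<Longrightarrow> harmonic i (f i)"
    and f: "\<And>x. x \<in> Gr k \<Longrightarrow> u x = (\<Sum>i\<le>k. up i (f i) x)"
    using harmonic_decomposition[OF kl(2), of u] by blast
  obtain g where hg: "\<And>i. i \<le> l \<Longrightarrow> harmonic i (g i)"
    and g: "\<And>x. x \<in> Gr l \<Longrightarrow> u x = (\<Sum>i\<le>l. up i (g i) x)"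
    using harmonic_decomposition[OF kl'(1), of u] by blast
  let ?N = "opp_count Q n" and ?\<nu> = "norm_factor Q n"
  note decomposed_k = inner_decomposed[where k = k and f = f, OF hf _ _ kl(2) f]
  note decomposed_l = inner_decomposed[where k = l and f = g, OF hg _ _ kl'(1) g]
  have uu_k: "inner_Gr k u u = (\<Sum>i\<le>k. 1 * ?\<nu> i k * inner_Gr i (f i) (f i))"
    by (rule decomposed_k) (simp_all add: hf f)
  have uu_l: "inner_Gr l u u = (\<Sum>i\<le>l. 1 * ?\<nu> i l * inner_Gr i (g i) (g i))"
    by (rule decomposed_l) (simp_all add: hg g)
  have opp_f: "opp k u x = (\<Sum>i\<le>k. (?N i k k * eps i) * up i (f i) x)" if "x \<in> Gr k" for x
  proof -
    have "opp k u x = opp k (\<lambda>y. \<Sum>i\<le>k. up i (f i) y) x" by (rule opp_cong) (rule f)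
    thus ?thesis using opp_up_harmonic[OF hf that] kl by (simp add: opp_sum)
  qed
  have opp_g: "opp l u x = (\<Sum>i\<le>l. (?N i l d * eps i) * up i (g i) x)" if "x \<in> Gr d" "d + l \<le> n" for x d
  proof -
    have "opp l u x = opp l (\<lambda>y. \<Sum>i\<le>l. up i (g i) y) x" by (rule opp_cong) (rule g)
    thus ?thesis using opp_up_harmonic[OF hg that(1)] that(2) by (simp add: opp_sum)
  qed
  have kk: "inner_Gr k u (opp k u) = (\<Sum>i\<le>k. ?N i k k * eps i * ?\<nu> i k * inner_Gr i (f i) (f i))"
    by (rule decomposed_k) (simp_all add: hf opp_f)
  have kl_form: "inner_Gr k u (opp l u) = (\<Sum>i\<le>l. ?N i l k * eps i * ?\<nu> i k * inner_Gr i (f i) (g i))"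
    by (rule decomposed_k) (use kl kl' in \<open>simp_all add: hg opp_g\<close>)
  have ll: "inner_Gr l u (opp l u) = (\<Sum>i\<le>l. ?N i l l * eps i * ?\<nu> i l * inner_Gr i (g i) (g i))"
    by (rule decomposed_l) (use kl' in \<open>simp_all add: hg opp_g\<close>)
  have one: "up 0 (\<lambda>_. 1) x = 1" if "subspace x" for x
  proof -
    have "{z. z \<in> Gr 0 \<and> z \<subseteq> x} = {{0}}" using subspace_0[OF that] by (auto simp: Gr_0)
    thus ?thesis by (simp add: up_def)
  qed
  have h0: "harmonic i (\<lambda>_. 1)" if "i \<le> 0" for i using that by (simp add: harmonic_def)
  \<comment> \<open>The sum is the pairing with the constant 1, a lift from level 0, so only the
    level-0 component survives.\<close>
  have total: "(\<Sum>x\<in>Gr d. u x) = ?\<nu> 0 d * f' 0 {0}"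
    if "\<And>i. i \<le> d \<Longrightarrow> harmonic i (f' i)" "\<And>x. x \<in> Gr d \<Longrightarrow> u x = (\<Sum>i\<le>d. up i (f' i) x)" "2 * d \<le> n"
    for d f'
  proof -
    have "(\<Sum>x\<in>Gr d. u x) = inner_Gr d u (up 0 (\<lambda>_. 1))"
      by (simp add: inner_Gr_def one Gr_iff)
    also have "\<dots> = (\<Sum>i\<le>0. 1 * ?\<nu> i d * inner_Gr i (f' i) (\<lambda>_. 1))"
      by (rule inner_decomposed[where f = f', OF that(1) h0 _ that(3,2)]) simp_all
    also have "\<dots> = ?\<nu> 0 d * f' 0 {0}" by (simp add: inner_Gr_def Gr_0)
    finally show ?thesis .
  qed
  define A where "A = (\<lambda>i. (\<alpha> - a * (?N i k k * eps i)) * ?\<nu> i k)"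
  define D where "D = (\<lambda>i. (\<alpha> - c * (?N i l l * eps i)) * ?\<nu> i l)"
  define E where "E = (\<lambda>i. b * (?N i l k * eps i) * ?\<nu> i k + (if i = 0 then ?\<nu> 0 k * ?\<nu> 0 l / 2 else 0))"
  have nu: "0 \<le> ?\<nu> i d" if "i \<le> d" "2 * d \<le> n" for i d
    using that Q_pos unfolding norm_factor_def by (intro mult_nonneg_nonneg less_imp_le[OF qbinom_pos]) auto
  have A: "0 \<le> A i" if "i \<le> k" for i
    using single[of i] blk1[of i] nu[of i k] that kl unfolding A_def by (cases "i \<le> l") auto
  have D: "0 \<le> D i" if "i \<le> l" for i
    using blk2[of i] nu[of i l] that kl' unfolding D_def by auto
  have E: "(E i)\<^sup>2 \<le> A i * D i" if "i \<le> l" for i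
    using det[OF that] by (simp only: A_def D_def E_def)
  have sq: "0 \<le> inner_Gr i v v" for i v
    by (simp add: inner_Gr_def sum_nonneg)
  have block: "0 \<le> A i * inner_Gr i (f i) (f i) + D i * inner_Gr i (g i) (g i) - 2 * E i * inner_Gr i (f i) (g i)"
    if "i \<le> l" for i
  proof -
    \<comment> \<open>\<open>psd_block\<close> is applied to the two values at each single
      \<open>z\<close>, so no Cauchy-Schwarz inequality is required.\<close>
    have "0 \<le> (\<Sum>z\<in>Gr i. A i * (f i z)\<^sup>2 + D i * (g i z)\<^sup>2 - 2 * E i * (f i z * g i z))"
      using A[of i] D[of i] E[of i] that kl by (intro sum_nonneg psd_block) auto
    thus ?thesis
      by (simp add: inner_Gr_def sum.distrib sum_subtractf sum_distrib_left power2_eq_square)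
  qed
  have "0 \<le> (\<Sum>i\<in>{l<..k}. A i * inner_Gr i (f i) (f i)) +
     (\<Sum>i\<le>l. A i * inner_Gr i (f i) (f i) + D i * inner_Gr i (g i) (g i) - 2 * E i * inner_Gr i (f i) (g i))"
    using A sq block by (intro add_nonneg_nonneg sum_nonneg mult_nonneg_nonneg) auto
  also have "\<dots> = (\<Sum>i\<le>k. A i * inner_Gr i (f i) (f i)) + (\<Sum>i\<le>l. D i * inner_Gr i (g i) (g i))
      - (\<Sum>i\<le>l. 2 * E i * inner_Gr i (f i) (g i))"
  proof -
    have "{..k} = {..l} \<union> {l<..k}" "{..l} \<inter> {l<..k} = {}" using kl by auto
    hence "(\<Sum>i\<le>k. A i * inner_Gr i (f i) (f i)) =
        (\<Sum>i\<le>l. A i * inner_Gr i (f i) (f i)) + (\<Sum>i\<in>{l<..k}. A i * inner_Gr i (f i) (f i))"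
      by (simp add: sum.union_disjoint)
    thus ?thesis by (simp add: sum.distrib sum_subtractf)
  qed
  also have "(\<Sum>i\<le>k. A i * inner_Gr i (f i) (f i)) = \<alpha> * inner_Gr k u u - a * inner_Gr k u (opp k u)"
    unfolding uu_k kk A_def
    by (simp add: sum_distrib_left left_diff_distrib right_diff_distrib sum_subtractf mult_ac)
  also have "(\<Sum>i\<le>l. D i * inner_Gr i (g i) (g i)) = \<alpha> * inner_Gr l u u - c * inner_Gr l u (opp l u)"
    unfolding uu_l ll D_def
    by (simp add: sum_distrib_left left_diff_distrib right_diff_distrib sum_subtractf mult_ac)
  also have "(\<Sum>i\<le>l. 2 * E i * inner_Gr i (f i) (g i)) =
      2 * b * inner_Gr k u (opp l u) + (\<Sum>x\<in>Gr k. u x) * (\<Sum>y\<in>Gr l. u y)"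
  proof -
    have "(\<Sum>i\<le>l. 2 * E i * inner_Gr i (f i) (g i)) =
      (\<Sum>i\<le>l. 2 * b * (?N i l k * eps i * ?\<nu> i k * inner_Gr i (f i) (g i)) +
        (if i = 0 then ?\<nu> 0 k * ?\<nu> 0 l * inner_Gr 0 (f 0) (g 0) else 0))"
      by (rule sum.cong) (auto simp: E_def algebra_simps)
    also have "\<dots> = 2 * b * inner_Gr k u (opp l u) + ?\<nu> 0 k * ?\<nu> 0 l * inner_Gr 0 (f 0) (g 0)"
      unfolding kl_form by (simp add: sum.distrib sum_distrib_left)
    also have "?\<nu> 0 k * ?\<nu> 0 l * inner_Gr 0 (f 0) (g 0) = (\<Sum>x\<in>Gr k. u x) * (\<Sum>y\<in>Gr l. u y)"
    proof -
      have "(\<Sum>x\<in>Gr k. u x) = ?\<nu> 0 k * f 0 {0}" by (rule total) (use hf f kl in blast)+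
      moreover have "(\<Sum>x\<in>Gr l. u x) = ?\<nu> 0 l * g 0 {0}" by (rule total) (use hg g kl' in blast)+
      ultimately show ?thesis by (simp only: inner_Gr_def Gr_0) simp
    qed
    finally show ?thesis .
  qed
  finally show ?thesis by simp
qed

section \<open>The matrices of the problem as quadratic forms\<close>

definition qform :: "'v smat \<Rightarrow> ('v set \<Rightarrow> real) \<Rightarrow> real" where
  "qform M u = (\<Sum>x\<in>subspaces scale. \<Sum>y\<in>subspaces scale. u x * M x y * u y)"

lemma qform_add: "qform (\<lambda>x y. M x y + M' x y) u = qform M u + qform M' u"
  by (simp add: qform_def distrib_left distrib_right sum.distrib)

lemma qform_diff: "qform (\<lambda>x y. M x y - M' x y) u = qform M u - qform M' u"
  by (simp add: qform_def left_diff_distrib right_diff_distrib sum_subtractf)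

lemma qform_scale: "qform (\<lambda>x y. c * M x y) u = c * qform M u"
  by (simp add: qform_def sum_distrib_left mult_ac)

text \<open>\<open>I_mat\<close>, \<open>J_mat\<close> and \<open>W_bar\<close> are all indicator
  matrices of a relation between two Grassmannians, so this one computation evaluates each of
  them.\<close>

lemma qform_relation:
  "qform (\<lambda>x y. if x \<in> Gr k \<and> y \<in> Gr l \<and> P x y then 1 else 0) u =
    (\<Sum>x\<in>Gr k. u x * (\<Sum>y | y \<in> Gr l \<and> P x y. u y))"
proof -
  have sub: "Gr d \<subseteq> subspaces scale" for d by (auto simp: subspaces_dim_def)
  have "qform (\<lambda>x y. if x \<in> Gr k \<and> y \<in> Gr l \<and> P x y then 1 else 0) u =
      (\<Sum>x\<in>subspaces scale. if x \<in> Gr k then u x * (\<Sum>y | y \<in> Gr l \<and> P x y. u y) else 0)"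
    unfolding qform_def
  proof (rule sum.cong)
    fix x assume "x \<in> subspaces scale"
    have "(\<Sum>y\<in>subspaces scale. u x * (if x \<in> Gr k \<and> y \<in> Gr l \<and> P x y then 1 else 0) * u y) =
        (if x \<in> Gr k then \<Sum>y\<in>subspaces scale. if y \<in> Gr l \<and> P x y then u x * u y else 0 else 0)"
      by (auto intro: sum.cong sum.neutral)
    also have "(\<Sum>y\<in>subspaces scale. if y \<in> Gr l \<and> P x y then u x * u y else 0) =
        (\<Sum>y | y \<in> Gr l \<and> P x y. u x * u y)"
      by (rule sum.mono_neutral_cong_right) (use sub in auto)
    finally show "(\<Sum>y\<in>subspaces scale. u x * (if x \<in> Gr k \<and> y \<in> Gr l \<and> P x y then 1 else 0) * u y) =
        (if x \<in> Gr k then u x * (\<Sum>y | y \<in> Gr l \<and> P x y. u y) else 0)"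
      by (simp add: sum_distrib_left)
  qed simp
  also have "\<dots> = (\<Sum>x\<in>Gr k. u x * (\<Sum>y | y \<in> Gr l \<and> P x y. u y))"
    by (rule sum.mono_neutral_cong_right) (use sub in auto)
  finally show ?thesis .
qed

lemma I_mat_eq: "I_mat scale k = (\<lambda>x y. if x \<in> Gr k \<and> y \<in> Gr k \<and> x = y then 1 else 0)"
proof -
  have "dim (x \<inter> y) = k \<longleftrightarrow> x = y" if "x \<in> Gr k" "y \<in> Gr k" for x y
  proof
    assume "dim (x \<inter> y) = k"
    hence "x \<inter> y \<in> Gr k" using that by (simp add: Gr_iff subspace_inter)
    thus "x = y" using Gr_eq[of "x \<inter> y" k x] Gr_eq[of "x \<inter> y" k y] that by auto
  qed (use that in \<open>simp add: Gr_iff\<close>)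
  thus ?thesis by (intro ext) (simp add: I_mat_def W_mat_def cong: conj_cong)
qed

text \<open>The conjunct \<open>True\<close> gives the right-hand side the shape that
  \<open>qform_relation\<close> rewrites.\<close>

lemma J_mat_eq: "J_mat scale k l = (\<lambda>x y. if x \<in> Gr k \<and> y \<in> Gr l \<and> True then 1 else 0)"
proof -
  have row: "(\<Sum>z\<in>subspaces scale. I_mat scale d x z) = (if x \<in> Gr d then 1 else 0)"
    and col: "(\<Sum>z\<in>subspaces scale. I_mat scale d z x) = (if x \<in> Gr d then 1 else 0)" for d x
  proof -
    have "(\<Sum>z\<in>subspaces scale. if z = x then (if x \<in> Gr d then 1 else 0 :: real) else 0) =
        (if x \<in> Gr d then 1 else 0)"
      by (auto simp: sum.delta subspaces_dim_def)
    moreover have "I_mat scale d x z = (if z = x then (if x \<in> Gr d then 1 else 0) else 0)"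
      "I_mat scale d z x = (if z = x then (if x \<in> Gr d then 1 else 0) else 0)" for z
      by (auto simp: I_mat_eq)
    ultimately show "(\<Sum>z\<in>subspaces scale. I_mat scale d x z) = (if x \<in> Gr d then 1 else 0)"
      "(\<Sum>z\<in>subspaces scale. I_mat scale d z x) = (if x \<in> Gr d then 1 else 0)"
      by simp_all
  qed
  show ?thesis
    by (intro ext) (simp add: J_mat_def smat_mult_def row col flip: sum_distrib_left)
qed

lemma qform_I: "qform (I_mat scale k) u = inner_Gr k u u"
proof -
  have "{y. y \<in> Gr k \<and> x = y} = {x}" if "x \<in> Gr k" for x using that by auto
  thus ?thesis unfolding I_mat_eq qform_relation inner_Gr_def by (intro sum.cong) auto
qed

lemma qform_J: "qform (J_mat scale k l) u = (\<Sum>x\<in>Gr k. u x) * (\<Sum>y\<in>Gr l. u y)"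
  unfolding J_mat_eq qform_relation by (simp add: sum_distrib_right)

lemma qform_W_bar: "qform (W_bar scale k l) u = inner_Gr k u (opp l u)"
  unfolding W_bar_def qform_relation inner_Gr_def opp_def ..

lemma W_bar_transpose: "W_bar scale k l x y = W_bar scale l k y x"
  by (auto simp: W_bar_def Int_commute)

lemma qform_transpose: "qform (\<lambda>x y. M y x) u = qform M u"
  unfolding qform_def by (subst sum.swap) (simp add: mult_ac)

lemma slack_mat_symmetric:
  assumes "smat_symmetric scale A"
  shows "smat_symmetric scale (slack_mat scale k l \<alpha> \<beta> \<gamma> A)"
proof -
  have "I_mat scale d x y = I_mat scale d y x" for d x y by (auto simp: I_mat_eq)
  moreover have "J_mat scale k l x y = J_mat scale l k y x" for x y by (auto simp: J_mat_eq)
  ultimately show ?thesis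
    using assms W_bar_transpose[of k l] by (simp add: smat_symmetric_def slack_mat_def add.commute)
qed

lemma qform_slack_mat:
  "qform (slack_mat scale k l \<alpha> \<beta> \<gamma> (\<lambda>x y. a * W_bar scale k k x y + c * W_bar scale l l x y)) u =
    \<alpha> * inner_Gr k u u + \<beta> * inner_Gr l u u - (\<Sum>x\<in>Gr k. u x) * (\<Sum>y\<in>Gr l. u y)
    - 2 * \<gamma> * inner_Gr k u (opp l u) - a * inner_Gr k u (opp k u) - c * inner_Gr l u (opp l u)"
proof -
  \<comment> \<open>By transposition the two off-diagonal disjointness terms agree, whence the
    factor 2 at \<open>\<gamma>\<close>.\<close>
  have "inner_Gr l u (opp k u) = inner_Gr k u (opp l u)"
    using qform_transpose[of "W_bar scale k l" u] W_bar_transpose[of k l]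
    by (simp add: qform_W_bar)
  thus ?thesis
    unfolding slack_mat_def qform_add qform_diff qform_scale qform_I qform_J qform_W_bar by simp
qed

end

section \<open>Positivity of the blocks\<close>

text \<open>The numerical data of the theorem, detached from the vector space. The products of a
  power of q and a Gaussian coefficient are written as level-0 opposite counts, and the equation for
  \<open>a\<close> is divided by \<open>q - 1\<close>. The squares of \<open>sk\<close> and
  \<open>sl\<close> count the \<open>k\<close>- and \<open>l\<close>-spaces through a point.\<close>

locale dual_solution =
  fixes q :: real and n k l :: nat and a b :: "real \<Rightarrow> real" and sk sl c :: real
  assumes q: "2 \<le> q" and l: "1 \<le> l" and lk: "l < k" and kn: "2 * k \<le> n"
    and sk: "sk = sqrt (qbinom q (n - 1) (k - 1))"
    and sl: "sl = sqrt (qbinom q (n - 1) (l - 1))"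
    and c: "c = sk * sl"
    and a: "\<And>lam. opp_count q n 0 k k * qnum q k * a lam =
      1/2 * (q ^ l * qnum q (k - l)) * c + opp_count q n 0 l l * qnum q l * lam"
    and b: "\<And>lam. opp_count q n 0 l k * b lam =
      - (1/2) * (q ^ l * qbinom q (n - 1) l) - opp_count q n 0 l l * sl / sk * lam"
begin

abbreviation N :: "nat \<Rightarrow> nat \<Rightarrow> nat \<Rightarrow> real" where "N \<equiv> opp_count q n"
abbreviation \<nu> :: "nat \<Rightarrow> nat \<Rightarrow> real" where "\<nu> \<equiv> norm_factor q n"
abbreviation e :: "nat \<Rightarrow> real" where "e \<equiv> qnum q"
abbreviation \<epsilon> :: "nat \<Rightarrow> real" where "\<epsilon> \<equiv> qsign q"

lemma q_pos: "0 < q"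
  using q by linarith

lemma bounds: "k + l \<le> n" "2 * l \<le> n" "l + l \<le> n" "k + k \<le> n" "l + k \<le> n"
  using lk kn by auto

lemma sk_pos: "0 < sk" and sl_pos: "0 < sl"
  unfolding sk sl using lk kn q_pos by (auto intro!: qbinom_pos)

lemma c_pos: "0 < c"
  using sk_pos sl_pos c by simp

lemma sk_sq: "sk * sk = qbinom q (n - 1) (k - 1)" and sl_sq: "sl * sl = qbinom q (n - 1) (l - 1)"
proof -
  have "0 < qbinom q (n - 1) (k - 1)" "0 < qbinom q (n - 1) (l - 1)"
    using lk kn q_pos by (auto intro!: qbinom_pos)
  thus "sk * sk = qbinom q (n - 1) (k - 1)" "sl * sl = qbinom q (n - 1) (l - 1)"
    unfolding sk sl by auto
qed

text \<open>Incident pairs of a point and a \<open>d\<close>-space, counted from both sides; [n] is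
  the number of points.\<close>

lemma \<nu>_0: "0 < d \<Longrightarrow> d \<le> n \<Longrightarrow> \<nu> 0 d * e d = e n * qbinom q (n - 1) (d - 1)"
  using qbinom_Suc_Suc[OF q_pos, of "n - 1" "d - 1"] by (simp add: norm_factor_def)

lemma \<nu>_k: "\<nu> 0 k * e k = e n * (sk * sk)" and \<nu>_l: "\<nu> 0 l * e l = e n * (sl * sl)"
  using \<nu>_0[of k] \<nu>_0[of l] lk kn l by (simp_all add: sk_sq sl_sq)

lemma gauss_l: "qbinom q (n - 1) l * e l = sl * sl * e (n - l)"
  using qbinom_Suc[OF q_pos, of "n - 1" "l - 1"] l by (simp add: sl_sq)

lemma e_pos: "0 < m \<Longrightarrow> 0 < e m"
  using q_pos by (rule qnum_pos)

text \<open>The Pascal rule: \<open>l\<close>-spaces through a fixed point and those avoiding it. It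
  lets the all-ones term of block 0 cancel against the constant term of the equation for
  \<open>b\<close>.\<close>

lemma pascal: "\<nu> 0 l = sl * sl + q ^ l * qbinom q (n - 1) l"
proof -
  have "e n = e l + q ^ l * e (n - l)" using bounds by (intro qnum_diff) auto
  hence "\<nu> 0 l * e l = sl * sl * e l + q ^ l * (sl * sl * e (n - l))"
    unfolding \<nu>_l by (simp add: algebra_simps)
  also have "\<dots> = (sl * sl + q ^ l * qbinom q (n - 1) l) * e l"
    unfolding gauss_l[symmetric] by (simp add: algebra_simps)
  finally show ?thesis using e_pos[of l] l by simp
qed

lemma e_k: "e k = e l + q ^ l * e (k - l)"
  using lk by (intro qnum_diff) simp

lemma e_nl: "q ^ l * e (n - l) = q ^ l * e (k - l) + q ^ k * e (n - k)"
proof -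
  have "e (n - l) = e (k - l) + q ^ (k - l) * e (n - l - (k - l))"
    using lk kn by (intro qnum_diff) auto
  moreover have "n - l - (k - l) = n - k" using lk kn by auto
  moreover have "q ^ k = q ^ l * q ^ (k - l)" using lk by (simp flip: power_add)
  ultimately show ?thesis by (simp add: algebra_simps)
qed

text \<open>
  The first two blocks are singular for every \<open>lam\<close>: the characteristic vector of the \<open>k\<close>- and
  \<open>l\<close>-spaces through a point, weighted by \<open>1 / sk\<close> and \<open>1 / sl\<close>, lies in the kernel of the slack
  matrix and has components in the blocks 0 and 1 only.
\<close>

lemma det_0:
  "(b lam * (N 0 l k * \<epsilon> 0) * \<nu> 0 k + \<nu> 0 k * \<nu> 0 l / 2)\<^sup>2 =
    (c / 2 - a lam * (N 0 k k * \<epsilon> 0)) * \<nu> 0 k * ((c / 2 - lam * (N 0 l l * \<epsilon> 0)) * \<nu> 0 l)"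
  and diag_0: "(c / 2 - a lam * (N 0 k k * \<epsilon> 0)) * e k = (c / 2 - lam * (N 0 l l * \<epsilon> 0)) * e l"
proof -
  \<comment> \<open>All entries of block 0 are multiples of \<open>T\<close>, by \<open>diag\<close>
    and \<open>off\<close>; the determinant identity then reduces to \<open>ratio\<close>.\<close>
  define T where "T = c / 2 - lam * N 0 l l"
  have ek: "e k > 0" using e_pos lk by simp
  have diag: "(c / 2 - a lam * N 0 k k) * e k = T * e l"
    using a[of lam] e_k by (simp add: T_def algebra_simps)
  thus "(c / 2 - a lam * (N 0 k k * \<epsilon> 0)) * e k = (c / 2 - lam * (N 0 l l * \<epsilon> 0)) * e l"
    by (simp add: T_def)
  have off: "(b lam * N 0 l k + \<nu> 0 l / 2) * sk = T * sl"
  proof -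
    have "b lam * N 0 l k + \<nu> 0 l / 2 = sl * sl / 2 - N 0 l l * sl / sk * lam"
      unfolding pascal using b[of lam] by (simp add: add_divide_distrib mult.commute[of "b lam"])
    thus ?thesis using sk_pos by (simp add: T_def c field_simps)
  qed
  have ratio: "sl * sl * (\<nu> 0 k * e k) = sk * sk * (\<nu> 0 l * e l)"
    unfolding \<nu>_k \<nu>_l by (simp only: mult_ac)
  have "(sk * sk * e k) * (b lam * N 0 l k * \<nu> 0 k + \<nu> 0 k * \<nu> 0 l / 2)\<^sup>2 =
      ((b lam * N 0 l k + \<nu> 0 l / 2) * sk)\<^sup>2 * \<nu> 0 k * (\<nu> 0 k * e k)"
    by (simp add: power2_eq_square algebra_simps)
  also have "\<dots> = T\<^sup>2 * \<nu> 0 k * (sl * sl * (\<nu> 0 k * e k))"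
    unfolding off by (simp add: power2_eq_square mult_ac)
  also have "\<dots> = (sk * sk) * \<nu> 0 k * (T * \<nu> 0 l) * (T * e l)"
    unfolding ratio by (simp add: power2_eq_square mult_ac)
  also have "\<dots> = (sk * sk * e k) * ((c / 2 - a lam * N 0 k k) * \<nu> 0 k * (T * \<nu> 0 l))"
    unfolding diag[symmetric] by (simp only: mult_ac)
  finally show "(b lam * (N 0 l k * \<epsilon> 0) * \<nu> 0 k + \<nu> 0 k * \<nu> 0 l / 2)\<^sup>2 =
    (c / 2 - a lam * (N 0 k k * \<epsilon> 0)) * \<nu> 0 k * ((c / 2 - lam * (N 0 l l * \<epsilon> 0)) * \<nu> 0 l)"
    using ek sk_pos by (simp add: T_def)
qed

text \<open>The determinant of block 1 with its norm factors cancelled through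
  \<open>opp_count_norm_factor\<close>. The plus signs come from
  \<open>\<epsilon> 1 = -1\<close>.\<close>

lemma det_1: "(b lam)\<^sup>2 * (N 1 l k * N 1 k l) = (c / 2 + a lam * N 1 k k) * (c / 2 + lam * N 1 l l)"
proof -
  \<comment> \<open>Multiplication by \<open>X\<close> or \<open>Y\<close> turns level-1 counts into
    level-0 counts, in which the equations for \<open>a\<close> and \<open>b\<close> are
    stated.\<close>
  define X where "X = q ^ k * e (n - k)"
  define Y where "Y = q ^ l * e (n - l)"
  define T where "T = c / 2 + lam * N 1 l l"
  have XY: "X > 0" "Y > 0" and Y_eq: "Y = q ^ l * e (k - l) + X"
    unfolding X_def Y_def using q_pos lk kn l by (auto intro!: mult_pos_pos e_pos e_nl)
  have el: "e l > 0" using e_pos l by simp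
  note rec = opp_count_rec[OF q_pos, of 0, simplified]
  have kk: "N 1 k k * X = N 0 k k * e k" and ll: "N 1 l l * Y = N 0 l l * e l"
    and lk': "N 1 l k * X = N 0 l k * e l" and kl': "N 1 k l * Y = N 0 k l * e k"
    using rec[of k k n] rec[of l l n] rec[of l k n] rec[of k l n] lk l bounds
    by (simp_all add: X_def Y_def)
  have diag: "(c / 2 + a lam * N 1 k k) * X = Y * T"
  proof -
    have "(c / 2 + a lam * N 1 k k) * X = c / 2 * X + a lam * (N 1 k k * X)" by (simp add: algebra_simps)
    also have "\<dots> = c / 2 * X + N 0 k k * e k * a lam"
      by (simp only: kk mult.commute[of "a lam"])
    also have "\<dots> = c / 2 * X + (1/2 * (q ^ l * e (k - l)) * c + N 0 l l * e l * lam)"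
      by (simp only: a)
    also have "\<dots> = Y * T" by (simp add: ll[symmetric] T_def) (simp add: Y_eq algebra_simps)
    finally show ?thesis .
  qed
  have off: "b lam * (N 1 l k * X) * sk = - (Y * sl * T)"
  proof -
    have "b lam * (N 1 l k * X) * sk = (N 0 l k * b lam) * e l * sk"
      unfolding lk' by (simp only: mult_ac)
    also have "\<dots> = - (1/2) * (q ^ l * (qbinom q (n - 1) l * e l)) * sk - N 0 l l * e l * sl * lam"
      unfolding b using sk_pos by (simp add: field_simps)
    also have "\<dots> = - (1/2) * (Y * (sl * sl)) * sk - N 1 l l * Y * sl * lam"
      unfolding gauss_l ll by (simp add: Y_def mult_ac)
    also have "\<dots> = - (Y * sl * T)" by (simp add: T_def c algebra_simps)
    finally show ?thesis .
  qed
  have ratio: "N 1 k l * Y * (sl * sl) = N 1 l k * X * (sk * sk)"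
  proof -
    have \<nu>l: "\<nu> 0 l > 0" using norm_factor_pos[of q 0 l n] q_pos bounds by simp
    have "\<nu> 0 l * (N 0 k l * e k * (sl * sl)) = N 0 k l * \<nu> 0 l * e k * (sl * sl)" by (simp only: mult_ac)
    also have "\<dots> = N 0 l k * (\<nu> 0 k * e k) * (sl * sl)"
      using opp_count_norm_factor[of 0 l k n q] bounds by simp
    also have "\<dots> = N 0 l k * (\<nu> 0 l * e l) * (sk * sk)"
      unfolding \<nu>_k \<nu>_l by (simp only: mult_ac)
    finally have "\<nu> 0 l * (N 0 k l * e k * (sl * sl)) = \<nu> 0 l * (N 0 l k * e l * (sk * sk))"
      by (simp only: mult_ac)
    hence "N 0 k l * e k * (sl * sl) = N 0 l k * e l * (sk * sk)" using \<nu>l by simp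
    thus ?thesis by (simp only: kl' lk')
  qed
  have "(b lam)\<^sup>2 * (N 1 l k * N 1 k l) * (X * Y * (sl * sl) * X) =
      (b lam)\<^sup>2 * N 1 l k * X * X * (N 1 k l * Y * (sl * sl))" by (simp only: mult_ac)
  also have "\<dots> = (b lam * (N 1 l k * X) * sk)\<^sup>2 * X"
    unfolding ratio by (simp only: power2_eq_square mult_ac)
  also have "\<dots> = (Y * T) * (Y * T) * (sl * sl) * X"
    unfolding off by (simp only: power2_eq_square mult_ac minus_mult_minus)
  also have "\<dots> = ((c / 2 + a lam * N 1 k k) * T) * (X * Y * (sl * sl) * X)"
    by (subst (1) diag[symmetric]) (simp only: mult_ac)
  finally show ?thesis using XY sl_pos by (simp add: T_def)
qed

section \<open>Decay of the eigenvalues at \<open>lam = 0\<close>\<close>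

lemma a_nonneg: "0 \<le> lam \<Longrightarrow> 0 \<le> a lam"
proof -
  assume lam: "0 \<le> lam"
  have p: "0 < N 0 k k * e k" "0 < N 0 l l" "0 < e l" "0 < e (k - l)"
    using opp_count_pos[OF q_pos, of 0] bounds e_pos lk l by (auto intro!: mult_pos_pos)
  have "0 \<le> N 0 k k * e k * a lam"
    unfolding a using p lam c_pos q_pos by (intro add_nonneg_nonneg mult_nonneg_nonneg) auto
  thus ?thesis using p(1) by (simp add: zero_le_mult_iff)
qed

text \<open>At level 0 the equation for \<open>a\<close> gives the bound, since q^l [k-l] is at most
  [k]. Each step divides the count by at least q^k and multiplies the sign factor by q^i, and 2 q^i
  <= q^(i+1) <= q^k.\<close>

lemma diag_decay:
  "i \<le> k \<Longrightarrow> a 0 * (N i k k * \<bar>\<epsilon> i\<bar>) \<le> c / 2 * (1/2) ^ i"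
proof (induction i)
  case 0
  have "e k > 0" using e_pos lk by simp
  moreover have "a 0 * N 0 k k * e k = c / 2 * (q ^ l * e (k - l))" using a[of 0] by (simp add: mult_ac)
  hence "a 0 * N 0 k k * e k \<le> c / 2 * e k"
    using e_k c_pos e_pos[of l] l by simp
  ultimately show ?case by simp
next
  case (Suc i)
  have "2 * q ^ i \<le> q ^ Suc i" using q by simp
  also have "\<dots> \<le> q ^ k" using Suc.prems q by (intro power_increasing) auto
  finally have "N (Suc i) k k * (2 * q ^ i) \<le> N (Suc i) k k * q ^ k"
    using opp_count_pos[OF q_pos, of "Suc i" k k n] Suc.prems bounds by (intro mult_left_mono) auto
  also have "\<dots> \<le> N i k k" using Suc.prems bounds q_pos by (intro opp_count_decreasing) auto
  finally have "N (Suc i) k k * (2 * q ^ i) * \<bar>\<epsilon> i\<bar> \<le> N i k k * \<bar>\<epsilon> i\<bar>" by (intro mult_right_mono) auto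
  hence "2 * (N (Suc i) k k * \<bar>\<epsilon> (Suc i)\<bar>) \<le> N i k k * \<bar>\<epsilon> i\<bar>"
    by (simp add: abs_qsign_Suc[OF q_pos] mult_ac)
  hence "a 0 * (2 * (N (Suc i) k k * \<bar>\<epsilon> (Suc i)\<bar>)) \<le> a 0 * (N i k k * \<bar>\<epsilon> i\<bar>)"
    using a_nonneg[of 0] by (intro mult_left_mono) auto
  also have "\<dots> \<le> c / 2 * (1/2) ^ i" using Suc by simp
  finally show ?case by simp
qed

lemma diag_small:
  assumes "1 \<le> i" "i \<le> k"
  shows "a 0 * (N i k k * \<bar>\<epsilon> i\<bar>) \<le> c / 4"
proof -
  have "(1/2 :: real) ^ i \<le> (1/2) ^ 1" using assms by (intro power_decreasing) auto
  hence "c / 2 * (1/2) ^ i \<le> c / 2 * (1/2)" using c_pos by simp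
  thus ?thesis using diag_decay[OF assms(2)] by simp
qed

lemma diag_pos:
  assumes "1 \<le> i" "i \<le> k"
  shows "c / 4 \<le> c / 2 - a 0 * (N i k k * \<epsilon> i)"
proof -
  have "a 0 * (N i k k * \<epsilon> i) \<le> a 0 * (N i k k * \<bar>\<epsilon> i\<bar>)"
    using a_nonneg[of 0] opp_count_pos[OF q_pos, of i k k n] assms bounds
    by (intro mult_left_mono) auto
  thus ?thesis using diag_small[OF assms] by simp
qed

text \<open>The two counts lose q^(k+l) together and the squared sign factor gains q^(2i). From
  \<open>i < l < k\<close> follows \<open>k + l >= 2 * i + 3\<close>, so at least q^3 >= 8 is
  gained.\<close>

lemma off_diag_decay:
  assumes "i < l"
  shows "8 * (N (Suc i) l k * N (Suc i) k l * (\<epsilon> (Suc i))\<^sup>2) \<le> N i l k * N i k l * (\<epsilon> i)\<^sup>2"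
proof -
  have p: "0 < N (Suc i) l k" "0 < N (Suc i) k l" "0 < N i l k" "0 < N i k l"
    using assms lk bounds by (auto intro!: opp_count_pos[OF q_pos])
  have "8 * (q ^ i)\<^sup>2 \<le> q ^ 3 * (q ^ i)\<^sup>2"
    using power_mono[OF q, of 3] by (intro mult_right_mono) auto
  also have "\<dots> = q ^ (3 + 2 * i)" by (simp add: power_add power_mult mult.commute)
  also have "\<dots> \<le> q ^ (k + l)" using assms lk q by (intro power_increasing) auto
  finally have pw: "8 * (q ^ i)\<^sup>2 \<le> q ^ k * q ^ l" by (simp add: power_add)
  have "(\<epsilon> (Suc i))\<^sup>2 = (q ^ i)\<^sup>2 * (\<epsilon> i)\<^sup>2" by (simp add: qsign_def power_mult_distrib)
  hence "8 * (N (Suc i) l k * N (Suc i) k l * (\<epsilon> (Suc i))\<^sup>2) =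
      N (Suc i) l k * N (Suc i) k l * (8 * (q ^ i)\<^sup>2) * (\<epsilon> i)\<^sup>2" by (simp add: mult_ac)
  also have "\<dots> \<le> N (Suc i) l k * N (Suc i) k l * (q ^ k * q ^ l) * (\<epsilon> i)\<^sup>2"
    using p pw by (intro mult_right_mono mult_left_mono) auto
  also have "\<dots> = (N (Suc i) l k * q ^ k) * (N (Suc i) k l * q ^ l) * (\<epsilon> i)\<^sup>2" by (simp only: mult_ac)
  also have "\<dots> \<le> N i l k * N i k l * (\<epsilon> i)\<^sup>2"
    using p q_pos assms lk bounds
    by (intro mult_right_mono mult_mono opp_count_decreasing) auto
  finally show ?thesis .
qed

lemma off_diag_small:
  assumes "2 \<le> i" "i \<le> l"
  shows "8 * (N i l k * N i k l * (\<epsilon> i)\<^sup>2) \<le> N 1 l k * N 1 k l"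
  using assms
proof (induction i rule: dec_induct)
  case base
  thus ?case using off_diag_decay[of 1] by (simp add: numeral_2_eq_2)
next
  case (step i)
  have "0 \<le> N (Suc i) l k * N (Suc i) k l * (\<epsilon> (Suc i))\<^sup>2"
    using opp_count_pos[OF q_pos, of "Suc i" l k n] opp_count_pos[OF q_pos, of "Suc i" k l n] step lk bounds
    by auto
  moreover have "0 \<le> N i l k * N i k l * (\<epsilon> i)\<^sup>2"
    using opp_count_pos[OF q_pos, of i l k n] opp_count_pos[OF q_pos, of i k l n] step lk bounds
    by auto
  ultimately show ?case using off_diag_decay[of i] step by simp
qed

text \<open>\<open>det_1\<close> at 0 replaces \<open>(b 0)^2\<close> by diagonal entries of block
  1, giving at most (3c/4)(c/2); \<open>off_diag_small\<close> leaves an eighth of it. This is below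
  (c/4)(c/2), the lower bound from \<open>diag_pos\<close>.\<close>

lemma det_strict:
  assumes "2 \<le> i" "i \<le> l"
  shows "(b 0)\<^sup>2 * (N i l k * N i k l * (\<epsilon> i)\<^sup>2) < (c / 2 - a 0 * (N i k k * \<epsilon> i)) * (c / 2)"
proof -
  have "8 * ((b 0)\<^sup>2 * (N i l k * N i k l * (\<epsilon> i)\<^sup>2)) = (b 0)\<^sup>2 * (8 * (N i l k * N i k l * (\<epsilon> i)\<^sup>2))"
    by simp
  also have "\<dots> \<le> (b 0)\<^sup>2 * (N 1 l k * N 1 k l)"
    using off_diag_small[OF assms] by (intro mult_left_mono) auto
  also have "\<dots> = (c / 2 + a 0 * N 1 k k) * (c / 2)" using det_1[of 0] by simp
  also have "\<dots> \<le> (c / 2 + c / 4) * (c / 2)"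
    using diag_small[of 1] lk c_pos by (intro mult_right_mono) auto
  also have "\<dots> < 8 * (c / 4 * (c / 2))" using c_pos by simp
  also have "\<dots> \<le> 8 * ((c / 2 - a 0 * (N i k k * \<epsilon> i)) * (c / 2))"
    using diag_pos[of i] assms lk c_pos by (intro mult_left_mono mult_right_mono) auto
  finally show ?thesis by (rule mult_left_less_imp_less) simp
qed

section \<open>Small positive values of \<open>lam\<close>\<close>

lemma a_tendsto: "(a \<longlongrightarrow> a 0) (at_right 0)" and b_tendsto: "(b \<longlongrightarrow> b 0) (at_right 0)"
proof -
  have p: "0 < N 0 k k * e k" "0 < N 0 l k"
    using opp_count_pos[OF q_pos, of 0] bounds e_pos lk by (auto intro!: mult_pos_pos)
  have "a = (\<lambda>lam. (1/2 * (q ^ l * e (k - l)) * c + N 0 l l * e l * lam) / (N 0 k k * e k))"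
    by (rule ext, subst eq_divide_eq) (use p a in \<open>auto simp: mult.commute\<close>)
  moreover have "((\<lambda>lam. (1/2 * (q ^ l * e (k - l)) * c + N 0 l l * e l * lam) / (N 0 k k * e k)) \<longlongrightarrow>
     (1/2 * (q ^ l * e (k - l)) * c + N 0 l l * e l * 0) / (N 0 k k * e k)) (at_right 0)"
    using p by (intro tendsto_intros) auto
  ultimately show "(a \<longlongrightarrow> a 0) (at_right 0)" by metis
  have "b = (\<lambda>lam. (- (1/2) * (q ^ l * qbinom q (n - 1) l) - N 0 l l * sl / sk * lam) / N 0 l k)"
    by (rule ext) (use p b in \<open>simp add: eq_divide_eq mult.commute\<close>)
  moreover have "((\<lambda>lam. (- (1/2) * (q ^ l * qbinom q (n - 1) l) - N 0 l l * sl / sk * lam) / N 0 l k) \<longlongrightarrow>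
     (- (1/2) * (q ^ l * qbinom q (n - 1) l) - N 0 l l * sl / sk * 0) / N 0 l k) (at_right 0)"
    using p by (intro tendsto_intros) auto
  ultimately show "(b \<longlongrightarrow> b 0) (at_right 0)" by metis
qed

text \<open>Only conditions strict at 0 can be carried over by continuity. The determinants
  therefore start at \<open>i = 2\<close>, and the first diagonal starts at \<open>i = 1\<close>
  because its level-0 entry follows from \<open>diag_0\<close>.\<close>

lemma eventually_blocks:
  "\<forall>\<^sub>F lam in at_right 0. 0 < lam \<and>
    (\<forall>i\<in>{1..k}. 0 < c / 2 - a lam * (N i k k * \<epsilon> i)) \<and>
    (\<forall>i\<in>{..l}. 0 < c / 2 - lam * (N i l l * \<epsilon> i)) \<and>
    (\<forall>i\<in>{2..l}. (b lam)\<^sup>2 * (N i l k * N i k l * (\<epsilon> i)\<^sup>2) <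
      (c / 2 - a lam * (N i k k * \<epsilon> i)) * (c / 2 - lam * (N i l l * \<epsilon> i)))"
proof (intro eventually_conj)
  show "\<forall>\<^sub>F lam in at_right 0. 0 < (lam :: real)" by (rule eventually_at_right_less)
  have A: "((\<lambda>lam. c / 2 - a lam * (N i k k * \<epsilon> i)) \<longlongrightarrow> c / 2 - a 0 * (N i k k * \<epsilon> i)) (at_right 0)" for i
    by (intro tendsto_intros a_tendsto)
  have D: "((\<lambda>lam. c / 2 - lam * (N i l l * \<epsilon> i)) \<longlongrightarrow> c / 2 - 0 * (N i l l * \<epsilon> i)) (at_right 0)" for i
    by (intro tendsto_intros)
  show "\<forall>\<^sub>F lam in at_right 0. \<forall>i\<in>{1..k}. 0 < c / 2 - a lam * (N i k k * \<epsilon> i)"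
  proof (intro eventually_ball_finite ballI)
    fix i assume "i \<in> {1..k}"
    hence "0 < c / 2 - a 0 * (N i k k * \<epsilon> i)" using diag_pos[of i] c_pos by simp
    thus "\<forall>\<^sub>F lam in at_right 0. 0 < c / 2 - a lam * (N i k k * \<epsilon> i)"
      by (rule order_tendstoD(1)[OF A])
  qed simp
  show "\<forall>\<^sub>F lam in at_right 0. \<forall>i\<in>{..l}. 0 < c / 2 - lam * (N i l l * \<epsilon> i)"
    using c_pos by (intro eventually_ball_finite ballI order_tendstoD(1)[OF D]) auto
  show "\<forall>\<^sub>F lam in at_right 0. \<forall>i\<in>{2..l}. (b lam)\<^sup>2 * (N i l k * N i k l * (\<epsilon> i)\<^sup>2) <
      (c / 2 - a lam * (N i k k * \<epsilon> i)) * (c / 2 - lam * (N i l l * \<epsilon> i))"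
  proof (intro eventually_ball_finite ballI)
    fix i assume i: "i \<in> {2..l}"
    have "((\<lambda>lam. (c / 2 - a lam * (N i k k * \<epsilon> i)) * (c / 2 - lam * (N i l l * \<epsilon> i)) -
        (b lam)\<^sup>2 * (N i l k * N i k l * (\<epsilon> i)\<^sup>2)) \<longlongrightarrow>
      (c / 2 - a 0 * (N i k k * \<epsilon> i)) * (c / 2 - 0 * (N i l l * \<epsilon> i)) -
        (b 0)\<^sup>2 * (N i l k * N i k l * (\<epsilon> i)\<^sup>2)) (at_right 0)"
      by (intro tendsto_intros a_tendsto b_tendsto)
    moreover have "0 < (c / 2 - a 0 * (N i k k * \<epsilon> i)) * (c / 2 - 0 * (N i l l * \<epsilon> i)) -
        (b 0)\<^sup>2 * (N i l k * N i k l * (\<epsilon> i)\<^sup>2)"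
      using det_strict[of i] i by simp
    ultimately have "\<forall>\<^sub>F lam in at_right 0. 0 < (c / 2 - a lam * (N i k k * \<epsilon> i)) *
        (c / 2 - lam * (N i l l * \<epsilon> i)) - (b lam)\<^sup>2 * (N i l k * N i k l * (\<epsilon> i)\<^sup>2)"
      by (rule order_tendstoD(1))
    thus "\<forall>\<^sub>F lam in at_right 0. (b lam)\<^sup>2 * (N i l k * N i k l * (\<epsilon> i)\<^sup>2) <
      (c / 2 - a lam * (N i k k * \<epsilon> i)) * (c / 2 - lam * (N i l l * \<epsilon> i))" by simp
  qed simp
qed

lemma eventually_psd_blocks:
  "\<forall>\<^sub>F lam in at_right 0. 0 < lam \<and>
    (\<forall>i\<le>k. 0 \<le> c / 2 - a lam * (N i k k * \<epsilon> i)) \<and>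
    (\<forall>i\<le>l. 0 \<le> c / 2 - lam * (N i l l * \<epsilon> i)) \<and>
    (\<forall>i\<le>l. (b lam * (N i l k * \<epsilon> i) * \<nu> i k + (if i = 0 then \<nu> 0 k * \<nu> 0 l / 2 else 0))\<^sup>2 \<le>
      (c / 2 - a lam * (N i k k * \<epsilon> i)) * \<nu> i k * ((c / 2 - lam * (N i l l * \<epsilon> i)) * \<nu> i l))"
  using eventually_blocks
proof eventually_elim
  case (elim lam)
  have ek: "e k > 0" "e l > 0" using e_pos lk l by auto
  have "0 \<le> (c / 2 - a lam * (N 0 k k * \<epsilon> 0)) * e k"
    unfolding diag_0 using elim ek(2) by (intro mult_nonneg_nonneg less_imp_le) blast+
  hence 0: "0 \<le> c / 2 - a lam * (N 0 k k * \<epsilon> 0)" using ek by (simp add: zero_le_mult_iff)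
  have A: "0 \<le> c / 2 - a lam * (N i k k * \<epsilon> i)" if "i \<le> k" for i
    using 0 elim that by (cases "i = 0") (auto simp: less_imp_le)
  have det: "(b lam * (N i l k * \<epsilon> i) * \<nu> i k + (if i = 0 then \<nu> 0 k * \<nu> 0 l / 2 else 0))\<^sup>2 \<le>
      (c / 2 - a lam * (N i k k * \<epsilon> i)) * \<nu> i k * ((c / 2 - lam * (N i l l * \<epsilon> i)) * \<nu> i l)"
    if i: "i \<le> l" for i
  proof (cases "i = 0")
    case True
    thus ?thesis using det_0[of lam] by simp
  next
    case False
    have pos: "0 < \<nu> i k" "0 < \<nu> i l" using norm_factor_pos[OF q_pos] i lk kn bounds by auto
    have le: "(b lam)\<^sup>2 * (N i l k * N i k l * (\<epsilon> i)\<^sup>2) \<le>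
      (c / 2 - a lam * (N i k k * \<epsilon> i)) * (c / 2 - lam * (N i l l * \<epsilon> i))"
    proof (cases "i = 1")
      case True
      thus ?thesis using det_1[of lam] by simp
    next
      case False
      thus ?thesis using elim i \<open>i \<noteq> 0\<close> by (auto simp: less_imp_le)
    qed
    \<comment> \<open>One of the two factors \<open>N i l k * \<nu> i k\<close> is exchanged for its
      mirror image, so that \<open>\<nu> i k * \<nu> i l\<close> splits off as on the right-hand
      side.\<close>
    have "(b lam * (N i l k * \<epsilon> i) * \<nu> i k)\<^sup>2 =
        (b lam)\<^sup>2 * N i l k * (\<epsilon> i)\<^sup>2 * \<nu> i k * (N i l k * \<nu> i k)"
      by (simp only: power2_eq_square mult_ac)
    also have "N i l k * \<nu> i k = N i k l * \<nu> i l"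
      using i lk bounds by (intro opp_count_norm_factor) auto
    also have "(b lam)\<^sup>2 * N i l k * (\<epsilon> i)\<^sup>2 * \<nu> i k * (N i k l * \<nu> i l) =
        (b lam)\<^sup>2 * (N i l k * N i k l * (\<epsilon> i)\<^sup>2) * (\<nu> i k * \<nu> i l)"
      by (simp only: mult_ac)
    also have "\<dots> \<le> (c / 2 - a lam * (N i k k * \<epsilon> i)) * (c / 2 - lam * (N i l l * \<epsilon> i)) * (\<nu> i k * \<nu> i l)"
      using le pos by (intro mult_right_mono) auto
    finally show ?thesis using False by (simp add: mult_ac)
  qed
  show ?case using elim A det by (auto simp: less_imp_le)
qed

end

section \<open>Transfer to the given vector space\<close>

theorem theorem2p1:
  fixes smul :: "'f::{field,finite} \<Rightarrow> 'v::ab_group_add \<Rightarrow> 'v"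
    and B :: "'v set"
    and q n k l :: nat
    and c :: real
    and a b :: "real \<Rightarrow> real"
  assumes "finite_dimensional_vector_space smul B"
    and "CARD('f) = q"
    and "vector_space.dim smul (UNIV :: 'v set) = n"
    and "1 \<le> l" and "l < k" and "k \<le> n div 2"
    and "c = sqrt (gauss_coeff q (int n - 1) (int k - 1)) * sqrt (gauss_coeff q (int n - 1) (int l - 1))"
    and "\<And>lam. real q ^ (k^2) * (real q ^ k - 1) * gauss_coeff q (int n - int k) k * a lam
           = 1/2 * real q ^ l * (real q ^ (k - l) - 1) * c
             + real q ^ (l^2) * (real q ^ l - 1) * gauss_coeff q (int n - int l) l * lam"
    and "\<And>lam. real q ^ (k * l) * gauss_coeff q (int n - int k) l * b lam
           = - (1/2) * real q ^ l * gauss_coeff q (int n - 1) l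
             - real q ^ (l^2) * gauss_coeff q (int n - int l) l
               * sqrt (gauss_coeff q (int n - 1) (int l - 1))
               / sqrt (gauss_coeff q (int n - 1) (int k - 1)) * lam"
  shows "\<exists>lam0>0. \<forall>lam. 0 < lam \<and> lam < lam0 \<longrightarrow>
           feasible_D smul k l (c / 2) (c / 2) (b lam)
             (\<lambda>x y. a lam * W_bar smul k k x y + lam * W_bar smul l l x y)"
proof -
  interpret V: finite_field_space smul B "real q"
    using assms(1,2) by (simp add: finite_field_space_def finite_field_space_axioms_def)
  have kn: "2 * k \<le> n" using assms(6) by simp
  have q1: "1 < real q" using V.Q_ge_2 by linarith
  have idx: "int n - 1 = int (n - 1)" "int k - 1 = int (k - 1)" "int l - 1 = int (l - 1)"
    "int n - int k = int (n - k)" "int n - int l = int (n - l)"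
    using assms(4,5) kn by auto
  have gauss: "gauss_coeff q (int n - 1) (int k - 1) = qbinom q (n - 1) (k - 1)"
    "gauss_coeff q (int n - 1) (int l - 1) = qbinom q (n - 1) (l - 1)"
    "gauss_coeff q (int n - 1) l = qbinom q (n - 1) l"
    "gauss_coeff q (int n - int k) k = qbinom q (n - k) k"
    "gauss_coeff q (int n - int k) l = qbinom q (n - k) l"
    "gauss_coeff q (int n - int l) l = qbinom q (n - l) l"
    unfolding idx by (rule gauss_coeff_eq_qbinom; use q1 assms(4,5) kn in simp)+
  have N: "opp_count q n 0 i j = real q ^ (j * i) * qbinom q (n - j) i" for i j
    by (simp add: opp_count_def)
  interpret S: dual_solution "real q" n k l a b
    "sqrt (qbinom q (n - 1) (k - 1))" "sqrt (qbinom q (n - 1) (l - 1))" c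
  proof
    fix lam
    \<comment> \<open>The theorem has q^m - 1 where the locale has [m]; the factor
      \<open>q - 1\<close> occurs once in every term and cancels.\<close>
    have "(real q - 1) * (opp_count q n 0 k k * qnum q k * a lam) =
      real q ^ (k^2) * (real q ^ k - 1) * gauss_coeff q (int n - int k) k * a lam"
      by (simp only: N gauss qnum_geometric[symmetric] power2_eq_square mult_ac)
    also have "\<dots> = (real q - 1) * (1/2 * (real q ^ l * qnum q (k - l)) * c + opp_count q n 0 l l * qnum q l * lam)"
      unfolding assms(8)
      by (simp only: N gauss qnum_geometric[symmetric] power2_eq_square distrib_left mult_ac)
    finally show "opp_count q n 0 k k * qnum q k * a lam =
      1/2 * (real q ^ l * qnum q (k - l)) * c + opp_count q n 0 l l * qnum q l * lam"
      using q1 by simp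
    show "opp_count q n 0 l k * b lam = - (1/2) * (real q ^ l * qbinom q (n - 1) l)
      - opp_count q n 0 l l * sqrt (qbinom q (n - 1) (l - 1)) / sqrt (qbinom q (n - 1) (k - 1)) * lam"
      using assms(9)[of lam] by (simp add: N gauss power2_eq_square mult.assoc)
  qed (use V.Q_ge_2 assms(4,5) kn in \<open>simp_all add: assms(7) gauss\<close>)
  obtain lam0 where lam0: "lam0 > 0" and *: "\<And>lam. 0 < lam \<Longrightarrow> lam < lam0 \<Longrightarrow>
    (\<forall>i\<le>k. 0 \<le> c / 2 - a lam * (opp_count q n i k k * qsign q i)) \<and>
    (\<forall>i\<le>l. 0 \<le> c / 2 - lam * (opp_count q n i l l * qsign q i)) \<and>
    (\<forall>i\<le>l. (b lam * (opp_count q n i l k * qsign q i) * norm_factor q n i k +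
        (if i = 0 then norm_factor q n 0 k * norm_factor q n 0 l / 2 else 0))\<^sup>2 \<le>
      (c / 2 - a lam * (opp_count q n i k k * qsign q i)) * norm_factor q n i k *
      ((c / 2 - lam * (opp_count q n i l l * qsign q i)) * norm_factor q n i l))"
    using S.eventually_psd_blocks unfolding eventually_at_right_field by blast
  show ?thesis
  proof (intro exI[of _ lam0] conjI allI impI)
    fix lam assume lam: "0 < lam \<and> lam < lam0"
    let ?A = "\<lambda>x y. a lam * W_bar smul k k x y + lam * W_bar smul l l x y"
    have sym: "smat_symmetric smul ?A"
      using V.W_bar_transpose[of k k] V.W_bar_transpose[of l l] by (simp add: smat_symmetric_def)
    have nonneg: "smat_nonneg smul ?A"
      using lam S.a_nonneg[of lam] by (auto simp: smat_nonneg_def W_bar_def)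
    have "0 \<le> V.qform (slack_mat smul k l (c / 2) (c / 2) (b lam) ?A) u" for u
      unfolding V.qform_slack_mat using *[of lam] lam assms(5) kn assms(3)
      by (intro V.quadratic_form_nonneg) auto
    thus "feasible_D smul k l (c / 2) (c / 2) (b lam) ?A"
      using sym nonneg V.slack_mat_symmetric[OF sym]
      by (simp add: feasible_D_def smat_psd_def V.qform_def)
  qed (rule lam0)
qed

end
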